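(* Let $n\ge2$ and let $(q,m)$ be the equal masses regular polygon configuration: $q_1,\dots,q_n$ are the vertices of a regular $n$-gon in the plane $\Pi=\{z=0\}\subset\mathbb{R}^3$ centered at the origin, and $m_1=\dots=m_n>0$ (this is a balanced central configuration). Suppose the primaries are in the associated rigid motion. Then there exists a synchronous solution if and only if $2\le n\le 472$.
   Context: Gravitational constant $1$. For $n=2$ the configuration is two antipodal points. Central configuration with constant $\lambda$: $\nabla_jU(q)+\lambda m_jq_j=0$ for all $j$, where $U(q)=\sum_{i<j}\frac{m_im_j}{|q_i-q_j|}$. Rigid motion: $x_j(t)=Q(\sqrt\lambda\,t)q_j$, with $Q(\theta)$ the rotation by angle $\theta$ about the $z$-axis; its minimal period is $T=2\pi/\sqrt\lambda$. Synchronous solution: a nonconstant periodic solution $z(t)$, with minimal period $T$, of the equation of motion of a massless particle on the $z$-axis, $\ddot z=-\sum_{i=1}^n\frac{m_iz}{(|q_i|^2+z^2)^{3/2}}$. *)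

theory Defs
  imports "HOL-Analysis.Analysis"
begin

text \<open>
  Configurations are functions from indices to \<open>\<real>\<^sup>3\<close>; the bodies carry the labels
  \<open>1, \<dots>, n\<close> and values at other indices are irrelevant.
\<close>

definition newton_potential ::
    "nat \<Rightarrow> (nat \<Rightarrow> real) \<Rightarrow> (nat \<Rightarrow> real ^ 3) \<Rightarrow> real" where
  "newton_potential n m q =
     (\<Sum>(i, j) \<in> {(i, j). 1 \<le> i \<and> i < j \<and> j \<le> n}. m i * m j / norm (q i - q j))"

definition central_configuration ::
    "nat \<Rightarrow> (nat \<Rightarrow> real) \<Rightarrow> (nat \<Rightarrow> real ^ 3) \<Rightarrow> real \<Rightarrow> bool" where
  "central_configuration n m q lam \<longleftrightarrow>
     inj_on q {1..n} \<and>
     (\<forall>j \<in> {1..n}. \<exists>g. GDERIV (\<lambda>y. newton_potential n m (q(j := y))) (q j) :> g \<and>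
                       g + (lam * m j) *\<^sub>R q j = 0)"

text \<open>
  The labelling of the vertices is arbitrary. For \<open>n = 2\<close> the vertices are two antipodal points.
\<close>

definition regular_polygon :: "nat \<Rightarrow> (nat \<Rightarrow> real ^ 3) \<Rightarrow> bool" where
  "regular_polygon n q \<longleftrightarrow>
     (\<exists>r > 0. \<exists>phi. bij_betw q {1..n}
        ((\<lambda>k. vector [r * cos (phi + 2 * pi * real k / real n),
                      r * sin (phi + 2 * pi * real k / real n), 0]) ` {..<n}))"

definition rotation_z :: "real \<Rightarrow> real ^ 3 ^ 3" where
  "rotation_z theta =
     vector [vector [cos theta, - sin theta, 0],
             vector [sin theta,   cos theta, 0],
             vector [0, 0, 1]]"

definition rigid_motion :: "real \<Rightarrow> (nat \<Rightarrow> real ^ 3) \<Rightarrow> nat \<Rightarrow> real \<Rightarrow> real ^ 3" where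
  "rigid_motion lam q j t = rotation_z (sqrt lam * t) *v q j"

definition minimal_period :: "(real \<Rightarrow> 'a) \<Rightarrow> real \<Rightarrow> bool" where
  "minimal_period f T \<longleftrightarrow>
     T > 0 \<and> (\<forall>t. f (t + T) = f t) \<and> (\<forall>S. 0 < S \<and> S < T \<longrightarrow> \<not> (\<forall>t. f (t + S) = f t))"

definition massless_particle_on_axis ::
    "nat \<Rightarrow> (nat \<Rightarrow> real) \<Rightarrow> (nat \<Rightarrow> real ^ 3) \<Rightarrow> (real \<Rightarrow> real) \<Rightarrow> bool" where
  "massless_particle_on_axis n m q z \<longleftrightarrow>
     (\<exists>z'. \<forall>t. (z has_real_derivative z' t) (at t) \<and>
        (z' has_real_derivative
           - (\<Sum>i = 1..n. m i * z t / ((norm (q i))\<^sup>2 + (z t)\<^sup>2) powr (3/2))) (at t))"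

definition synchronous_solution ::
    "nat \<Rightarrow> (nat \<Rightarrow> real) \<Rightarrow> (nat \<Rightarrow> real ^ 3) \<Rightarrow> real \<Rightarrow> (real \<Rightarrow> real) \<Rightarrow> bool" where
  "synchronous_solution n m q T z \<longleftrightarrow>
     massless_particle_on_axis n m q z \<and> \<not> z constant_on UNIV \<and> minimal_period z T"

lemma rotation_z_nth:
  "(rotation_z theta *v v) $ 1 = cos theta * v $ 1 - sin theta * v $ 2"
  "(rotation_z theta *v v) $ 2 = sin theta * v $ 1 + cos theta * v $ 2"
  "(rotation_z theta *v v) $ 3 = v $ 3"
  by (simp_all add: rotation_z_def matrix_vector_mult_def sum_3)

lemma rotation_z_mult:
  "rotation_z (a + b) *v v = rotation_z a *v (rotation_z b *v v)"
  by (simp add: vec_eq_iff forall_3 rotation_z_nth cos_add sin_add algebra_simps)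

lemma rotation_z_fixes:
  assumes "rotation_z theta *v v = v" "v $ 1 \<noteq> 0 \<or> v $ 2 \<noteq> 0"
  shows "cos theta = 1"
proof -
  have 1: "cos theta * v $ 1 - sin theta * v $ 2 = v $ 1"
    and 2: "sin theta * v $ 1 + cos theta * v $ 2 = v $ 2"
    using arg_cong[OF assms(1), of "\<lambda>w. w $ 1"] arg_cong[OF assms(1), of "\<lambda>w. w $ 2"]
    by (simp_all only: rotation_z_nth)
  have "cos theta * ((v $ 1)\<^sup>2 + (v $ 2)\<^sup>2)
      = (cos theta * v $ 1 - sin theta * v $ 2) * v $ 1
      + (sin theta * v $ 1 + cos theta * v $ 2) * v $ 2"
    by (simp add: algebra_simps power2_eq_square)
  also have "\<dots> = (v $ 1)\<^sup>2 + (v $ 2)\<^sup>2"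
    unfolding 1 2 by (simp add: power2_eq_square)
  finally show ?thesis
    using assms(2) by (auto simp: sum_power2_eq_zero_iff)
qed

lemma minimal_period_unique:
  assumes "minimal_period f S" "minimal_period f T"
  shows "S = T"
proof -
  have "\<not> S < T" "\<not> T < S"
    using assms unfolding minimal_period_def by blast+
  then show ?thesis by simp
qed

lemma rigid_motion_minimal_period:
  assumes "lam > 0" "\<exists>j \<in> {1..n}. q j $ 1 \<noteq> 0 \<or> q j $ 2 \<noteq> 0"
  shows "minimal_period (\<lambda>t. \<lambda>j \<in> {1..n}. rigid_motion lam q j t) T
           \<longleftrightarrow> T = 2 * pi / sqrt lam"
proof -
  let ?T = "2 * pi / sqrt lam"
  let ?x = "\<lambda>t. \<lambda>j \<in> {1..n}. rigid_motion lam q j t"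
  have s: "sqrt lam > 0" using assms(1) by simp
  have "?x (t + ?T) = ?x t" for t
  proof -
    have "sqrt lam * (t + ?T) = sqrt lam * t + 2 * pi"
      using s by (simp add: field_simps)
    then have "rotation_z (sqrt lam * (t + ?T)) = rotation_z (sqrt lam * t)"
      by (simp only: rotation_z_def cos_periodic sin_periodic)
    then show ?thesis by (simp only: rigid_motion_def)
  qed
  moreover have "\<not> (\<forall>t. ?x (t + S) = ?x t)" if S: "0 < S" "S < ?T" for S
  proof
    assume per: "\<forall>t. ?x (t + S) = ?x t"
    obtain j where j: "j \<in> {1..n}" "q j $ 1 \<noteq> 0 \<or> q j $ 2 \<noteq> 0"
      using assms(2) by blast
    have "rigid_motion lam q j S = rigid_motion lam q j 0"
      using fun_cong[OF per[rule_format, of 0], of j] j(1) by simp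
    moreover have "rotation_z 0 *v q j = q j"
      by (simp add: vec_eq_iff forall_3 rotation_z_nth)
    ultimately have "cos (sqrt lam * S) = 1"
      using rotation_z_fixes j(2) by (simp add: rigid_motion_def)
    moreover have "0 < sqrt lam * S" "sqrt lam * S < 2 * pi"
      using S s by (simp_all add: field_simps)
    moreover obtain k :: int where "sqrt lam * S = real_of_int k * 2 * pi"
      using \<open>cos (sqrt lam * S) = 1\<close> unfolding cos_one_2pi_int by blast
    ultimately have "0 < real_of_int k * (2 * pi)" "real_of_int k * (2 * pi) < 1 * (2 * pi)"
      by simp_all
    then have "0 < real_of_int k" "real_of_int k < 1"
      by (simp_all add: zero_less_mult_iff)
    then show False by simp
  qed
  ultimately have "minimal_period ?x ?T"
    using s by (simp add: minimal_period_def)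
  then show ?thesis using minimal_period_unique by blast
qed

end

theory Submission
  imports Defs
begin

text \<open>
  For bodies of mass \<open>\<mu>\<close> on a regular \<open>n\<close>-gon of radius \<open>r\<close>, the radial component of the equation
  of a central configuration gives \<open>\<lambda> = \<mu> S / (4 r\<^sup>3)\<close> with \<open>S = \<Sum>k=1..<n. csc (\<pi> k / n)\<close>. The
  nonconstant periodic motions on the axis have precisely the minimal periods above
  \<open>2 \<pi> / \<omega>\<close>, where \<open>\<omega>\<^sup>2 = n \<mu> / r\<^sup>3\<close> belongs to the linearisation at the origin: an angle in
  the phase plane moves with velocity less than \<open>\<omega>\<close>, and the period of the oscillation of
  amplitude \<open>a\<close> is an explicit integral that varies continuously from \<open>2 \<pi> / \<omega>\<close> to \<open>\<infinity>\<close>. Hence a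
  synchronous solution exists iff \<open>\<lambda> < \<omega>\<^sup>2\<close>, that is, \<open>S < 4 n\<close>.

  To decide this inequality, twelve terms at either end of \<open>S\<close> are compared with a Taylor
  polynomial and the remaining ones, by convexity of the cosecant, with the integral
  \<open>ln (tan (x / 2))\<close> through the midpoint and the trapezoidal rule. At the critical values
  \<open>n = 472, 473\<close> the margin is less than \<open>0.001 n\<close>.
\<close>

subsection \<open>Sums of cosecants\<close>

text \<open>The supporting line of slope \<open>s\<close> at the midpoint suffices, since its linear
  part integrates to zero over the symmetric interval. The integral is expressed by an
  antiderivative \<open>F\<close>.\<close>

lemma midpoint_le_integral:
  fixes f F :: "real \<Rightarrow> real"
  assumes "d \<ge> 0"
    and F: "\<And>x. x \<in> {c-d..c+d} \<Longrightarrow> (F has_real_derivative f x) (at x)"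
    and s: "\<And>x. x \<in> {c-d..c+d} \<Longrightarrow> s * (x - c) \<le> f x - f c"
  shows "2 * d * f c \<le> F (c + d) - F (c - d)"
proof -
  \<comment> \<open>The quadratic part of \<open>G\<close> is equal at both endpoints and drops out
    of the comparison.\<close>
  define G where "G = (\<lambda>x. F x - f c * x - s * (x - c)\<^sup>2 / 2)"
  have "G (c - d) \<le> G (c + d)"
  proof (rule DERIV_nonneg_imp_nondecreasing[where f = G])
    show "c - d \<le> c + d" using assms(1) by simp
    fix x assume x: "c - d \<le> x" "x \<le> c + d"
    have "(G has_real_derivative f x - f c - s * (x - c)) (at x)"
      unfolding G_def using x
      by (auto intro!: derivative_eq_intros F)
    then show "\<exists>y. (G has_real_derivative y) (at x) \<and> 0 \<le> y"
      using s[of x] x by auto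
  qed
  then show ?thesis by (simp add: G_def algebra_simps)
qed

text \<open>A convex function lies below its chord; \<open>G\<close> is an antiderivative of the
  chord minus \<open>F\<close>.\<close>

lemma integral_le_trapezoid:
  fixes f F :: "real \<Rightarrow> real"
  assumes "a < b" and f: "convex_on {a..b} f"
    and F: "\<And>x. x \<in> {a..b} \<Longrightarrow> (F has_real_derivative f x) (at x)"
  shows "F b - F a \<le> (b - a) * (f a + f b) / 2"
proof -
  define s where "s = (f b - f a) / (b - a)"
  define G where "G = (\<lambda>x. f a * x + s * (x - a)\<^sup>2 / 2 - F x)"
  have "G a \<le> G b"
  proof (rule DERIV_nonneg_imp_nondecreasing[where f = G])
    show "a \<le> b" using assms(1) by simp
    fix x assume x: "a \<le> x" "x \<le> b"
    have "(G has_real_derivative f a + s * (x - a) - f x) (at x)"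
      unfolding G_def using x
      by (auto intro!: derivative_eq_intros F)
    moreover have "f x \<le> s * (x - a) + f a"
      unfolding s_def using convex_onD_Icc'[OF f] x by auto
    ultimately show "\<exists>y. (G has_real_derivative y) (at x) \<and> 0 \<le> y" by force
  qed
  moreover have "s * (b - a) = f b - f a" using assms(1) by (simp add: s_def)
  then have "s * (b - a)\<^sup>2 = (f b - f a) * (b - a)" by (simp add: power2_eq_square)
  ultimately show ?thesis by (simp add: G_def field_simps)
qed

text \<open>For \<open>h = pi / n\<close> the sample points of the cosecant sum become integers.
  \<open>F\<close> is an antiderivative of \<open>f\<close>.\<close>

context
  fixes h :: real and f f' f'' F :: "real \<Rightarrow> real"
  assumes h: "h > 0"
  defines "f \<equiv> \<lambda>x. 1 / sin (h * x)"
    and "f' \<equiv> \<lambda>x. - h * cos (h * x) / (sin (h * x))\<^sup>2"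
    and "f'' \<equiv> \<lambda>x. h\<^sup>2 * (1 + (cos (h * x))\<^sup>2) / (sin (h * x)) ^ 3"
    and "F \<equiv> \<lambda>x. ln (tan (h * x / 2)) / h"
begin

lemma sin_scaled_pos: "x \<in> {0<..<pi/h} \<Longrightarrow> sin (h * x) > 0"
  using h by (intro sin_gt_zero) (auto simp: field_simps)

lemma csc_deriv:
  assumes "x \<in> {0<..<pi/h}"
  shows "(f has_real_derivative f' x) (at x)"
  unfolding f_def f'_def using sin_scaled_pos[OF assms]
  by (auto intro!: derivative_eq_intros simp: field_simps power2_eq_square)

lemma csc_deriv2:
  assumes "x \<in> {0<..<pi/h}"
  shows "(f' has_real_derivative f'' x) (at x)"
proof -
  have s: "sin (h * x) > 0" by (rule sin_scaled_pos[OF assms])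
  have "(f' has_real_derivative
     (h * (h * sin (h*x)) * (sin (h*x))\<^sup>2 + h * cos (h*x) * (2 * sin (h*x) * (cos (h*x) * h))) / ((sin (h*x))\<^sup>2)\<^sup>2) (at x)"
    unfolding f'_def using s
    by (auto intro!: derivative_eq_intros simp: power2_eq_square field_simps)
  also have "(h * (h * sin (h*x)) * (sin (h*x))\<^sup>2 + h * cos (h*x) * (2 * sin (h*x) * (cos (h*x) * h)))
     = sin (h*x) * (h\<^sup>2 * ((sin (h*x))\<^sup>2 + 2 * (cos (h*x))\<^sup>2))"
    by (simp add: power2_eq_square algebra_simps)
  also have "(sin (h*x))\<^sup>2 + 2 * (cos (h*x))\<^sup>2 = 1 + (cos (h*x))\<^sup>2"
    by (simp add: sin_squared_eq)
  also have "sin (h*x) * (h\<^sup>2 * (1 + (cos (h*x))\<^sup>2)) / ((sin (h*x))\<^sup>2)\<^sup>2 = f'' x"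
    using s by (simp add: f''_def field_simps power2_eq_square power3_eq_cube)
  finally show ?thesis .
qed

lemma csc_deriv2_nonneg: "x \<in> {0<..<pi/h} \<Longrightarrow> f'' x \<ge> 0"
  unfolding f''_def using sin_scaled_pos[of x] by simp

lemma ln_tan_deriv:
  assumes "x \<in> {0<..<pi/h}"
  shows "(F has_real_derivative f x) (at x)"
proof -
  have c: "cos (h * x / 2) > 0" "sin (h * x / 2) > 0"
    using assms h by (auto intro!: cos_gt_zero sin_gt_zero2 simp: field_simps)
  have s: "sin (h * x) = 2 * sin (h*x/2) * cos (h*x/2)"
    using sin_double[of "h*x/2"] by simp
  have "((\<lambda>x. ln (tan (h * x / 2))) has_real_derivative
      inverse (tan (h*x/2)) * (inverse ((cos (h*x/2))\<^sup>2) * (h / 2))) (at x)"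
    using c by (auto intro!: derivative_eq_intros) (auto simp: tan_def)
  from DERIV_cdivide[OF this, of h]
  have "(F has_real_derivative inverse (tan (h*x/2)) * (inverse ((cos (h*x/2))\<^sup>2) * (h / 2)) / h) (at x)"
    by (simp add: F_def)
  also have "inverse (tan (h*x/2)) * (inverse ((cos (h*x/2))\<^sup>2) * (h / 2)) / h = f x"
    unfolding f_def s tan_def using c h by (simp add: field_simps power2_eq_square)
  finally show ?thesis .
qed

lemma csc_above_tangent:
  assumes "x \<in> {0<..<pi/h}" "y \<in> {0<..<pi/h}"
  shows "f' x * (y - x) \<le> f y - f x"
  by (rule f''_imp_f'[of "{0<..<pi/h}"])
    (use assms csc_deriv csc_deriv2 csc_deriv2_nonneg in auto)

lemma convex_on_csc: "convex_on {0<..<pi/h} f"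
  by (rule f''_ge0_imp_convex[where f' = f' and f'' = f''])
    (use csc_deriv csc_deriv2 csc_deriv2_nonneg in auto)

text \<open>The integers are the midpoints of the unit intervals that tile
  \<open>[p - 1/2, q + 1/2]\<close>. The bound \<open>p \<le> Suc q\<close> admits the empty sum,
  which occurs below for \<open>n = 2 * K + 1\<close>.\<close>

lemma sum_csc_le:
  assumes "1 \<le> p" "p \<le> Suc q" "real q + 1/2 < pi / h"
  shows "(\<Sum>k=p..q. f (real k)) \<le> F (real q + 1/2) - F (real p - 1/2)"
proof -
  have "(\<Sum>k=p..q. f (real k)) \<le> (\<Sum>k=p..q. F (real (Suc k) - 1/2) - F (real k - 1/2))"
  proof (rule sum_mono)
    fix k assume k: "k \<in> {p..q}"
    then have "1 \<le> real k" "real k \<le> real q" using assms(1) by auto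
    then have *: "{real k - 1/2..real k + 1/2} \<subseteq> {0<..<pi/h}" using assms(3)
      by auto
    have "2 * (1/2) * f (real k) \<le> F (real k + 1/2) - F (real k - 1/2)"
    proof (rule midpoint_le_integral)
      fix x assume x: "x \<in> {real k - 1/2..real k + 1/2}"
      show "(F has_real_derivative f x) (at x)" using ln_tan_deriv x * by blast
      have "real k \<in> {0<..<pi/h}" using subsetD[OF *, of "real k"] by simp
      then show "f' (real k) * (x - real k) \<le> f x - f (real k)"
        using csc_above_tangent x * by blast
    qed simp
    then show "f (real k) \<le> F (real (Suc k) - 1/2) - F (real k - 1/2)"
      by (simp add: algebra_simps)
  qed
  also have "\<dots> = F (real (Suc q) - 1/2) - F (real p - 1/2)"
    using sum_Suc_diff[OF assms(2), of "\<lambda>k. F (real k - 1/2)"] by simp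
  finally show ?thesis by (simp add: algebra_simps)
qed

text \<open>Adding trapezoids over consecutive unit intervals gives inner terms weight 1 and the two
  end terms weight 1/2.\<close>

lemma sum_csc_ge:
  assumes "1 \<le> p" "p \<le> q" "real q < pi / h"
  shows "F (real q) - F (real p) \<le> (\<Sum>k=p..q. f (real k)) - (f (real p) + f (real q)) / 2"
  using assms(2,3)
proof (induction q rule: dec_induct)
  case base
  then show ?case by simp
next
  case (step q)
  have *: "{real q..real (Suc q)} \<subseteq> {0<..<pi/h}" using assms(1) step by auto
  have "F (real (Suc q)) - F (real q)
      \<le> (real (Suc q) - real q) * (f (real q) + f (real (Suc q))) / 2"
  proof (rule integral_le_trapezoid)
    show "convex_on {real q..real (Suc q)} f"
      using convex_on_subset[OF convex_on_csc *] by simp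
    show "(F has_real_derivative f x) (at x)" if "x \<in> {real q..real (Suc q)}" for x
      using ln_tan_deriv that * by blast
  qed simp
  moreover have "(real (Suc q) - real q) * (f (real q) + f (real (Suc q))) / 2
      = f (real q) / 2 + f (real (Suc q)) / 2" by (simp add: field_simps)
  ultimately show ?case using step by (simp add: field_simps)
qed

end

section \<open>Integral bounds for the whole cosecant sum\<close>

definition csc_sum :: "nat \<Rightarrow> real" where
  "csc_sum n = (\<Sum>k=1..<n. 1 / sin (pi * real k / real n))"

lemma csc_sum_pos:
  assumes "n \<ge> 2"
  shows "csc_sum n > 0"
  unfolding csc_sum_def using assms
  by (intro sum_pos) (auto intro!: divide_pos_pos sin_gt_zero simp: field_simps)

text \<open>The reflection \<open>k -> n - k\<close> preserves the cosecants, so the last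
  \<open>K\<close> terms repeat the first \<open>K\<close>.\<close>

lemma csc_sum_split:
  assumes "2 * K < n"
  shows "csc_sum n = 2 * (\<Sum>k=1..K. 1 / sin (pi * real k / real n))
      + (\<Sum>k=Suc K..n - K - 1. 1 / sin (pi * real k / real n))"
proof -
  let ?g = "\<lambda>k. 1 / sin (pi * real k / real n)"
  have "{1..<n} = {1..K} \<union> {Suc K..n - K - 1} \<union> {n - K..<n}"
    using assms by auto
  then have "csc_sum n = sum ?g ({1..K} \<union> {Suc K..n - K - 1} \<union> {n - K..<n})"
    by (simp only: csc_sum_def)
  also have "\<dots> = sum ?g {1..K} + sum ?g {Suc K..n - K - 1} + sum ?g {n - K..<n}"
    using assms by (subst sum.union_disjoint; (subst sum.union_disjoint)?) auto
  also have "sum ?g {n - K..<n} = sum ?g {1..K}"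
  proof (rule sum.reindex_bij_witness[of _ "\<lambda>k. n - k" "\<lambda>k. n - k"])
    fix k assume "k \<in> {n - K..<n}"
    then have "pi * real (n - k) / real n = pi - pi * real k / real n"
      by (simp add: of_nat_diff field_simps)
    then show "?g (n - k) = ?g k" by simp
  qed (use assms in auto)
  finally show ?thesis by simp
qed

text \<open>The two ends of the integral are mirror images; this identity merges their logarithms
  into one.\<close>

lemma ln_tan_compl: "ln (tan (pi/2 - x)) = - ln (tan x)"
  by (metis ln_inverse tan_cot tan_cot')

text \<open>Midpoint rule for the middle terms: the integral runs from \<open>K + 1/2\<close> to
  \<open>n - K - 1/2\<close>.\<close>

lemma csc_sum_le:
  assumes "2 * K < n"
  shows "csc_sum n \<le> 2 * (\<Sum>k=1..K. 1 / sin (pi * real k / real n))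
      - 2 * real n / pi * ln (tan (pi * (real K + 1/2) / (2 * real n)))"
proof -
  have n: "real n > 0" "pi / real n > 0" using assms by auto
  have m: "real (n - K - 1) = real n - real K - 1" using assms by linarith
  have a: "pi / real n * (real (n - K - 1) + 1 / 2) / 2
      = pi/2 - pi * (real K + 1/2) / (2 * real n)" unfolding m
    using n by (simp add: field_simps)
  have b: "pi / real n * (real (Suc K) - 1 / 2) / 2 = pi * (real K + 1/2) / (2 * real n)"
    using n by (simp add: field_simps)
  have "real (n - K - 1) + 1/2 < pi / (pi / real n)" unfolding m using n by simp
  moreover have "Suc K \<le> Suc (n - K - 1)" using assms by simp
  ultimately have "(\<Sum>k=Suc K..n - K - 1. 1 / sin (pi / real n * real k))
      \<le> ln (tan (pi / real n * (real (n - K - 1) + 1 / 2) / 2)) / (pi / real n)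
       - ln (tan (pi / real n * (real (Suc K) - 1 / 2) / 2)) / (pi / real n)"
    using sum_csc_le[OF n(2), of "Suc K" "n - K - 1"] by simp
  then show ?thesis unfolding csc_sum_split[OF assms] a b ln_tan_compl
    by (simp add: field_simps)
qed

text \<open>Trapezoidal rule on \<open>[K, n - K]\<close>: the two equal end terms of weight 1/2
  leave a single cosecant at \<open>K\<close>. The sum is therefore split after
  \<open>J = K - 1\<close> terms.\<close>

lemma csc_sum_ge:
  assumes "1 \<le> K" "2 * K \<le> n"
  shows "csc_sum n \<ge> 2 * (\<Sum>k=1..<K. 1 / sin (pi * real k / real n)) + 1 / sin (pi * real K / real n)
      - 2 * real n / pi * ln (tan (pi * real K / (2 * real n)))"
proof -
  have n: "real n > 0" "pi / real n > 0" using assms by auto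
  obtain J where K: "K = Suc J" using assms(1) by (cases K) auto
  have J: "2 * J < n" "n - J - 1 = n - K" "{1..J} = {1..<K}" using assms K by auto
  have m: "real (n - K) = real n - real K" using assms by linarith
  have a: "pi / real n * real (n - K) / 2
      = pi/2 - pi * real K / (2 * real n)" unfolding m
    using n by (simp add: field_simps)
  have b: "pi / real n * real K / 2 = pi * real K / (2 * real n)"
    using n by (simp add: field_simps)
  have c: "sin (pi / real n * real (n - K)) = sin (pi / real n * real K)"
  proof -
    have "pi / real n * real (n - K) = pi - pi / real n * real K"
      unfolding m using n by (simp add: field_simps)
    then show ?thesis by simp
  qed
  have "real (n - K) < pi / (pi / real n)" unfolding m using n assms by simp
  from sum_csc_ge[OF n(2), of K "n - K", OF _ _ this] assms
  show ?thesis unfolding csc_sum_split[OF J(1)] a b c ln_tan_compl J K[symmetric]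
    by (simp add: field_simps)
qed

section \<open>Taylor bounds for sine, cosecant and tangent\<close>

lemma sin_bounds_small:
  fixes x :: real
  assumes "0 \<le> x"
  shows "x - x ^ 3 / 6 - x ^ 5 / 120 \<le> sin x" "sin x \<le> x - x ^ 3 / 6 + x ^ 5 / 120"
proof -
  have "\<bar>sin x - (\<Sum>m<5. sin_coeff m * x ^ m)\<bar> \<le> inverse (fact 5) * \<bar>x\<bar> ^ 5"
    by (rule Maclaurin_sin_bound)
  also have "(\<Sum>m<5. sin_coeff m * x ^ m) = x - x ^ 3 / 6"
    by (simp add: lessThan_nat_numeral sin_coeff_def fact_numeral)
  also have "inverse (fact 5) * \<bar>x\<bar> ^ 5 = x ^ 5 / 120"
    using assms by (simp add: fact_numeral)
  finally show "x - x ^ 3 / 6 - x ^ 5 / 120 \<le> sin x" "sin x \<le> x - x ^ 3 / 6 + x ^ 5 / 120"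
    by linarith+
qed

lemma csc_ge:
  fixes x :: real
  assumes "0 < x" "x \<le> 1"
  shows "1 / x + x / 6 \<le> 1 / sin x"
proof -
  have s: "sin x > 0" using assms pi_gt3 by (intro sin_gt_zero) auto
  have "sin x * (6 + x\<^sup>2) \<le> (x - x ^ 3 / 6 + x ^ 5 / 120) * (6 + x\<^sup>2)"
    using assms by (intro mult_right_mono sin_bounds_small) auto
  also have "\<dots> = 6 * x - x ^ 5 * (14 - x\<^sup>2) / 120"
    by (simp add: field_simps power2_eq_square eval_nat_numeral)
  also have "\<dots> \<le> 6 * x"
    using assms power_le_one[of x 2] by simp
  finally show ?thesis using assms s
    by (simp add: field_simps power2_eq_square)
qed

text \<open>The coefficient 17/100 exceeds the Laurent coefficient 1/6 by 1/300, and up to 26/100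
  this slack absorbs the higher-order terms. The range covers twelve terms once
  \<open>n > 150\<close>.\<close>

lemma csc_le:
  fixes x :: real
  assumes "0 < x" "x \<le> 26/100"
  shows "1 / sin x \<le> 1 / x + 17/100 * x"
proof -
  have s: "sin x > 0" using assms pi_gt3 by (intro sin_gt_zero) auto
  have "x\<^sup>2 \<le> (26/100)\<^sup>2" using assms by (intro power_mono) auto
  then have x2: "x\<^sup>2 \<le> 7/100" by (simp add: power2_eq_square)
  moreover have "(x\<^sup>2)\<^sup>2 \<le> (7/100)\<^sup>2" using x2 by (intro power_mono) auto
  ultimately have *: "0 \<le> 1/300 - x\<^sup>2 * (22/600) - (x\<^sup>2)\<^sup>2 * (17/12000)"
    by (simp add: power2_eq_square)
  have "0 \<le> x ^ 3 * (1/300 - x\<^sup>2 * (22/600) - (x\<^sup>2)\<^sup>2 * (17/12000))"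
    using * assms by (intro mult_nonneg_nonneg) auto
  then have "x \<le> x + x ^ 3 * (1/300 - x\<^sup>2 * (22/600) - (x\<^sup>2)\<^sup>2 * (17/12000))"
    by simp
  also have "\<dots> = (x - x ^ 3 / 6 - x ^ 5 / 120) * (1 + 17/100 * x\<^sup>2)"
    by (simp add: field_simps power2_eq_square eval_nat_numeral)
  also have "\<dots> \<le> sin x * (1 + 17/100 * x\<^sup>2)"
    using assms by (intro mult_right_mono sin_bounds_small) auto
  finally show ?thesis using assms s
    by (simp add: field_simps power2_eq_square)
qed

text \<open>Since tan^2 = sin^2 / (1 - sin^2), a bound on the sine alone suffices; the condition on
  \<open>s\<close> and \<open>t\<close> is rational arithmetic.\<close>

lemma tan_le_of_sin_le:
  fixes u s t :: real
  assumes "0 < u" "u < pi/2" "sin u \<le> s" "s\<^sup>2 \<le> t\<^sup>2 * (1 - s\<^sup>2)" "0 < t"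
  shows "tan u \<le> t"
proof -
  have p: "sin u > 0" "cos u > 0" using assms by (auto intro: sin_gt_zero2 cos_gt_zero)
  have a: "(sin u)\<^sup>2 \<le> s\<^sup>2" using assms p by (intro power_mono) auto
  then have "t\<^sup>2 * (1 - s\<^sup>2) \<le> t\<^sup>2 * (1 - (sin u)\<^sup>2)" by (intro mult_left_mono) auto
  with a assms(4) have "(sin u)\<^sup>2 \<le> (t * cos u)\<^sup>2" by (simp add: power_mult_distrib cos_squared_eq)
  then have "sin u \<le> t * cos u" using assms p by (intro power2_le_imp_le[of "sin u"]) auto
  then show ?thesis using p by (simp add: tan_def field_simps)
qed

lemma tan_ge_of_sin_ge:
  fixes u s t :: real
  assumes "0 < u" "u < pi/2" "s \<le> sin u" "t\<^sup>2 * (1 - s\<^sup>2) \<le> s\<^sup>2" "0 \<le> s"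
  shows "t \<le> tan u"
proof -
  have p: "sin u > 0" "cos u > 0" using assms by (auto intro: sin_gt_zero2 cos_gt_zero)
  have a: "s\<^sup>2 \<le> (sin u)\<^sup>2" using assms p by (intro power_mono) auto
  then have "t\<^sup>2 * (1 - (sin u)\<^sup>2) \<le> t\<^sup>2 * (1 - s\<^sup>2)" by (intro mult_left_mono) auto
  with a assms(4) have "(t * cos u)\<^sup>2 \<le> (sin u)\<^sup>2" by (simp add: power_mult_distrib cos_squared_eq)
  then have "t * cos u \<le> sin u" using p by (intro power2_le_imp_le[of "t * cos u"]) auto
  then show ?thesis using p by (simp add: tan_def field_simps)
qed

text \<open>
  The bounds for \<open>csc_sum n\<close> below depend on \<open>n\<close> only through some \<open>u\<close> proportional to
  \<open>1/n\<close>; by the following monotonicity only \<open>n = 472\<close> and \<open>n = 473\<close> have to be evaluated.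
\<close>

lemma square_minus_ln_tan_antimono:
  fixes u v c :: real
  assumes "0 < u" "u \<le> v" "v \<le> 1" "0 \<le> c" "c \<le> 1/2"
  shows "c * v\<^sup>2 - ln (tan v) \<le> c * u\<^sup>2 - ln (tan u)"
proof -
  let ?G = "\<lambda>x. ln (tan x) - c * x\<^sup>2"
  have "?G u \<le> ?G v"
  proof (rule DERIV_nonneg_imp_nondecreasing[where f = ?G])
    fix x assume x: "u \<le> x" "x \<le> v"
    have x': "0 < x" "x \<le> 1" "x < pi/2" using assms x pi_gt3 by auto
    have p: "sin x > 0" "cos x > 0" using x' by (auto intro: sin_gt_zero2 cos_gt_zero)
    have "(?G has_real_derivative inverse (tan x) * inverse ((cos x)\<^sup>2) - c * (2 * x)) (at x)"
      using p by (auto intro!: derivative_eq_intros) (auto simp: tan_def)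
    \<comment> \<open>The right side is \<open>1 / (sin x * cos x)\<close>. As
      \<open>sin x * cos x \<le> x\<close>, it is enough that
      \<open>2 * c * x^2 \<le> 1\<close>.\<close>
    moreover have "c * (2 * x) \<le> inverse (tan x) * inverse ((cos x)\<^sup>2)"
    proof -
      have "sin x * cos x \<le> x * 1" using sin_x_le_x[of x] x' p by (intro mult_mono) auto
      then have "(c * (2 * x)) * (sin x * cos x) \<le> (c * (2 * x)) * x"
        using x' assms by (intro mult_left_mono) auto
      also have "\<dots> \<le> (1/2 * (2 * 1)) * 1"
        using x' assms by (intro mult_mono) auto
      finally show ?thesis using p by (simp add: tan_def field_simps power2_eq_square)
    qed
    ultimately show "\<exists>y. (?G has_real_derivative y) (at x) \<and> 0 \<le> y" by force
  qed (rule assms(2))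
  then show ?thesis by simp
qed

section \<open>Numerical values at \<open>n = 472\<close> and \<open>n = 473\<close>\<close>

lemma exp_Taylor_bounds:
  fixes z :: real
  assumes "\<bar>z\<bar> \<le> 1"
  shows "\<bar>exp z - (\<Sum>i\<le>10. z ^ i / fact i)\<bar> \<le> 1/1000000"
proof -
  have "\<bar>exp z - (\<Sum>i\<le>10. z ^ i / fact i)\<bar> \<le> exp \<bar>z\<bar> * \<bar>z\<bar> ^ Suc 10 / fact 10"
    using Taylor_exp_field[of z 10] by simp
  also have "\<dots> \<le> 3 * 1 / fact 10"
    using assms exp_le order_trans[of "exp \<bar>z\<bar>" "exp 1" 3]
    by (intro divide_right_mono mult_mono power_le_one) auto
  also have "\<dots> \<le> 1/1000000" by (simp add: fact_numeral)
  finally show ?thesis .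
qed

text \<open>A quarter of the exponent has modulus at most 1, where the Taylor polynomial is
  accurate; the fourth power restores the value. The number 399/10000 bounds the tangent at
  \<open>n = 473\<close> from above.\<close>

lemma exp_neg_3_2213: "399 / 10000 \<le> exp (- 32213 / 10000 :: real)"
proof -
  let ?z = "- 32213 / 40000 :: real"
  have "446937 / 1000000 \<le> exp ?z"
    using exp_Taylor_bounds[of ?z, unfolded abs_le_iff] by (simp add: eval_nat_numeral)
  then have "(446937 / 1000000) ^ 4 \<le> exp ?z ^ 4" by (intro power_mono) auto
  also have "exp ?z ^ 4 = exp (- 32213 / 10000)" by (simp flip: exp_of_nat_mult)
  finally show ?thesis by (simp add: eval_nat_numeral)
qed

lemma exp_neg_3_1792: "exp (- 31792 / 10000 :: real) \<le> 41621 / 1000000"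
proof -
  let ?z = "- 31792 / 40000 :: real"
  have "exp ?z \<le> 451674 / 1000000"
    using exp_Taylor_bounds[of ?z, unfolded abs_le_iff] by (simp add: eval_nat_numeral)
  then have "exp ?z ^ 4 \<le> (451674 / 1000000) ^ 4" by (intro power_mono) auto
  also have "exp ?z ^ 4 = exp (- 31792 / 10000)" by (simp flip: exp_of_nat_mult)
  finally show ?thesis by (simp add: eval_nat_numeral)
qed

text \<open>This is what the lower bound with \<open>K = 12\<close> requires at
  \<open>n = 473\<close> after division by \<open>2 * n / pi\<close>: 83711/27720 is the 11th
  harmonic number, 1/24 is half of 1/12, and \<open>u\<close> is half the angle
  \<open>12 * pi / n\<close>.\<close>

lemma ln_tan_at_473:
  defines "u \<equiv> 6 * pi / 473"
  shows "ln (tan u) < 83711/27720 + 1/24 + 1/3 * u\<^sup>2 - 2 * pi"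
proof -
  have u: "39851 / 1000000 \<le> u" "u \<le> 398511 / 10000000"
    using pi_approx by (auto simp: u_def)
  have "0 < tan u" using u pi_gt3 by (intro tan_gt_zero) auto
  have "u - u ^ 3 / 6 \<le> 398511 / 10000000 - (39851 / 1000000) ^ 3 / 6"
    using u by (intro diff_mono divide_right_mono power_mono) auto
  moreover have "u ^ 5 \<le> (398511 / 10000000) ^ 5" using u by (intro power_mono) auto
  ultimately have "sin u \<le> 3985 / 100000"
    using sin_bounds_small(2)[of u] u by (simp add: eval_nat_numeral)
  then have "tan u \<le> 399 / 10000"
    using u pi_gt3 by (intro tan_le_of_sin_le[of u "3985/100000"]) (auto simp: power2_eq_square)
  also note exp_neg_3_2213
  finally have "ln (tan u) \<le> ln (exp (- 32213 / 10000))"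
    using \<open>0 < tan u\<close> by (subst ln_le_cancel_iff) auto
  moreover have "(39851 / 1000000)\<^sup>2 \<le> u\<^sup>2" using u by (intro power_mono) auto
  ultimately show ?thesis using pi_approx by (simp add: power2_eq_square)
qed

text \<open>The analogue for the upper bound: 86021/27720 is the 12th harmonic number, and the
  midpoint rule makes \<open>u\<close> half the angle \<open>(12 + 1/2) * pi / n\<close>.\<close>

lemma ln_tan_at_472:
  defines "u \<equiv> 25 * pi / 1888"
  shows "86021/27720 + 34/100 * u\<^sup>2 - 2 * pi < ln (tan u)"
proof -
  have u: "41599 / 1000000 \<le> u" "u \<le> 41600 / 1000000" "41599475 / 1000000000 \<le> u"
    using pi_approx by (auto simp: u_def)
  have "0 < tan u" using u pi_gt3 by (intro tan_gt_zero) auto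
  have "u - u ^ 3 / 6 - u ^ 5 / 120 \<ge> 41599475 / 1000000000 - (41600 / 1000000) ^ 3 / 6 - (41600 / 1000000) ^ 5 / 120"
    using u by (intro diff_mono divide_right_mono power_mono) auto
  then have "41587 / 1000000 \<le> sin u"
    using sin_bounds_small(1)[of u] u by (simp add: eval_nat_numeral)
  then have "41621 / 1000000 \<le> tan u"
    using u pi_gt3 by (intro tan_ge_of_sin_ge[of u "41587 / 1000000"]) (auto simp: power2_eq_square)
  with exp_neg_3_1792 have "exp (- 31792 / 10000) \<le> tan u" by simp
  then have "- 31792 / 10000 \<le> ln (tan u)" using \<open>0 < tan u\<close> by (simp add: ln_ge_iff)
  moreover have "u\<^sup>2 \<le> (41600 / 1000000)\<^sup>2" using u by (intro power_mono) auto
  ultimately show ?thesis using pi_approx by (simp add: power2_eq_square)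
qed

section \<open>Comparison of \<open>csc_sum n\<close> with \<open>4 * n\<close>\<close>

text \<open>For small \<open>n\<close> the angles may leave the range of \<open>csc_le\<close>, but
  the margin is wide: the midpoint rule with \<open>K = 0\<close> and
  \<open>tan u \<ge> exp (- 6)\<close> give
  \<open>csc_sum n \<le> 12 * n / pi < 4 * n\<close>.\<close>

lemma csc_sum_less_small:
  assumes "2 \<le> n" "n \<le> 150"
  shows "csc_sum n < 4 * real n"
proof -
  define u where "u = pi / (4 * real n)"
  have n: "real n \<ge> 2" using assms by simp
  have u: "0 < u" "u \<le> 1/2" using n pi_less_4 by (auto simp: u_def field_simps)
  have "u ^ 2 \<le> (1/2) ^ 2" using u by (intro power_mono) auto
  moreover have "u ^ 4 \<le> (1/2) ^ 4" using u by (intro power_mono) auto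
  ultimately have "0 \<le> u * (1/10 - u\<^sup>2 / 6 - u ^ 4 / 120)"
    using u by (intro mult_nonneg_nonneg) (auto simp: eval_nat_numeral)
  then have "9/10 * u \<le> u - u ^ 3 / 6 - u ^ 5 / 120"
    by (simp add: algebra_simps eval_nat_numeral)
  also have "\<dots> \<le> sin u" using u by (intro sin_bounds_small) auto
  also have "\<dots> \<le> tan u"
    using u pi_gt3 cos_gt_zero[of u] sin_gt_zero2[of u] by (simp add: tan_def field_simps)
  finally have t: "9/10 * u \<le> tan u" .
  \<comment> \<open>From \<open>exp 1 \<ge> 5/2\<close> and \<open>u \<ge> 3/600\<close>, as
    \<open>(5/2)^6 * (9/10) * (3/600) > 1\<close>.\<close>
  have "exp (- 6) \<le> 9/10 * u"
  proof -
    have "(5/2) ^ 6 \<le> exp (1::real) ^ 6"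
      using exp_lower_Taylor_quadratic[of 1] by (intro power_mono) auto
    then have e: "(5/2) ^ 6 \<le> exp (6::real)" by (simp flip: exp_of_nat_mult)
    have "(5/2) ^ 6 * (9/10 * u) \<ge> (5/2) ^ 6 * (9/10 * (3 / 600))"
      using pi_gt3 n assms unfolding u_def
      by (intro mult_left_mono frac_le) auto
    then have "1 \<le> (5/2) ^ 6 * (9/10 * u)" by (simp add: eval_nat_numeral)
    also have "\<dots> \<le> exp 6 * (9/10 * u)" using u e by (intro mult_right_mono) auto
    finally show ?thesis by (simp add: exp_minus field_simps)
  qed
  with t have "exp (- 6) \<le> tan u" by simp
  then have "- 6 \<le> ln (tan u)" using t u by (subst ln_ge_iff) auto
  moreover have "csc_sum n \<le> - (2 * real n / pi * ln (tan u))"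
    using csc_sum_le[of 0 n] assms unfolding u_def by (simp add: field_simps)
  moreover have "- (2 * real n / pi * ln (tan u)) \<le> - (2 * real n / pi * (- 6))"
    using n calculation(1) by (intro le_imp_neg_le mult_left_mono) auto
  moreover have "2 * real n / pi * 6 < 4 * real n"
    using n pi_gt3 by (simp add: field_simps)
  ultimately show ?thesis by simp
qed

lemma csc_sum_less:
  assumes "2 \<le> n" "n \<le> 472"
  shows "csc_sum n < 4 * real n"
proof (cases "n \<le> 150")
  case True
  then show ?thesis using csc_sum_less_small assms by simp
next
  case False
  define u where "u = 25 * pi / (4 * real n)"
  have n: "150 < real n" "real n \<le> 472" using False assms by auto
  have u: "25 * pi / 1888 \<le> u" "u \<le> 1"
    using n pi_less_4 by (auto simp: u_def field_simps)
  have arg: "pi * (real 12 + 1/2) / (2 * real n) = u" by (simp add: u_def)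
  have le: "csc_sum n \<le> 2 * (\<Sum>k=1..12. 1 / sin (pi * real k / real n)) - 2 * real n / pi * ln (tan u)"
    using csc_sum_le[of 12 n, unfolded arg] n by simp
  have "(\<Sum>k=1..12. 1 / sin (pi * real k / real n))
     \<le> (\<Sum>k=1..12. real n / pi * (1 / real k) + 17/100 * (pi / real n) * real k)"
  proof (rule sum_mono)
    fix k :: nat assume k: "k \<in> {1..12}"
    have "pi * real k / real n \<le> 32/10 * 12 / 150"
      using k n pi_approx by (intro frac_le mult_mono) auto
    then have "1 / sin (pi * real k / real n)
      \<le> 1 / (pi * real k / real n) + 17/100 * (pi * real k / real n)"
      using k n by (intro csc_le) auto
    then show "1 / sin (pi * real k / real n)
      \<le> real n / pi * (1 / real k) + 17/100 * (pi / real n) * real k" by (simp add: field_simps)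
  qed
  also have "\<dots> = real n / pi * (86021/27720) + 17/100 * (pi / real n) * 78"
    by (simp only: sum.distrib sum_distrib_left[symmetric]) (simp add: eval_nat_numeral)
  \<comment> \<open>As \<open>u = 25/4 * (pi / n)\<close>, this amounts to
    \<open>78 \<le> 2 * (25/4)^2 = 78.125\<close>, where 78 = 1 + ... + 12.\<close>
  also have "\<dots> \<le> real n / pi * (86021/27720 + 34/100 * u\<^sup>2)"
    using n by (simp add: u_def field_simps power2_eq_square)
  finally have "csc_sum n \<le> 2 * (real n / pi * (86021/27720 + 34/100 * u\<^sup>2)) - 2 * real n / pi * ln (tan u)"
    using le by linarith
  also have "\<dots> = 2 * real n / pi * (86021/27720 + (34/100 * u\<^sup>2 - ln (tan u)))"
    by (simp add: field_simps)
  also have "\<dots> < 2 * real n / pi * (2 * pi)"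
  proof (rule mult_strict_left_mono)
    have "34/100 * u\<^sup>2 - ln (tan u) \<le> 34/100 * (25 * pi / 1888)\<^sup>2 - ln (tan (25 * pi / 1888))"
      using u by (intro square_minus_ln_tan_antimono) auto
    then show "86021/27720 + (34/100 * u\<^sup>2 - ln (tan u)) < 2 * pi"
      using ln_tan_at_472 by linarith
  qed (use n in auto)
  finally show ?thesis by (simp add: field_simps)
qed

lemma csc_sum_greater:
  assumes "473 \<le> n"
  shows "4 * real n < csc_sum n"
proof -
  define u where "u = 6 * pi / real n"
  have n: "473 \<le> real n" using assms by simp
  have u: "0 < u" "u \<le> 6 * pi / 473"
    using n by (auto simp: u_def field_simps)
  have arg: "pi * real 12 / (2 * real n) = u" by (simp add: u_def)
  have ge: "csc_sum n \<ge> 2 * (\<Sum>k=1..<12. 1 / sin (pi * real k / real n))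
      + 1 / sin (pi * real 12 / real n) - 2 * real n / pi * ln (tan u)"
    using csc_sum_ge[of 12 n, unfolded arg] n by simp
  have v: "6 * pi / 473 \<le> 1" using pi_less_4 by simp
  have k: "real n / pi * (1 / real k) + (pi / real n) / 6 * real k \<le> 1 / sin (pi * real k / real n)"
    if "k \<in> {1..12}" for k
  proof -
    have "pi * real k / real n \<le> 4 * 12 / 473"
      using that n pi_less_4 by (intro frac_le mult_mono) auto
    then have "1 / (pi * real k / real n) + (pi * real k / real n) / 6 \<le> 1 / sin (pi * real k / real n)"
      by (intro csc_ge) (use that n in simp, linarith)
    then show ?thesis by (simp add: field_simps)
  qed
  have "(\<Sum>k=1..<12. real n / pi * (1 / real k) + (pi / real n) / 6 * real k)
     \<le> (\<Sum>k=1..<12. 1 / sin (pi * real k / real n))"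
    by (rule sum_mono) (use k in auto)
  also have "(\<Sum>k=1..<12. real n / pi * (1 / real k) + (pi / real n) / 6 * real k)
     = real n / pi * (83711/27720) + (pi / real n) / 6 * 66"
    by (simp only: sum.distrib sum_distrib_left[symmetric]) (simp add: eval_nat_numeral)
  finally have "2 * (real n / pi * (83711/27720) + (pi / real n) / 6 * 66)
      + (real n / pi * (1 / 12) + (pi / real n) / 6 * 12) - 2 * real n / pi * ln (tan u) \<le> csc_sum n"
    using ge k[of 12] by simp
  \<comment> \<open>The quadratic terms match exactly:
    \<open>(2 * 66 + 12) / 6 = 24 = 2 * 36 / 3\<close>.\<close>
  also have "2 * (real n / pi * (83711/27720) + (pi / real n) / 6 * 66)
      + (real n / pi * (1 / 12) + (pi / real n) / 6 * 12) - 2 * real n / pi * ln (tan u)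
     = 2 * real n / pi * (83711/27720 + 1/24 + (1/3 * u\<^sup>2 - ln (tan u)))"
    using n by (simp add: u_def field_simps power2_eq_square)
  finally have a: "2 * real n / pi * (83711/27720 + 1/24 + (1/3 * u\<^sup>2 - ln (tan u))) \<le> csc_sum n" .
  have "2 * real n / pi * (2 * pi) < 2 * real n / pi * (83711/27720 + 1/24 + (1/3 * u\<^sup>2 - ln (tan u)))"
  proof (rule mult_strict_left_mono)
    have "1/3 * (6 * pi / 473)\<^sup>2 - ln (tan (6 * pi / 473)) \<le> 1/3 * u\<^sup>2 - ln (tan u)"
      using u v by (intro square_minus_ln_tan_antimono) auto
    then show "2 * pi < 83711/27720 + 1/24 + (1/3 * u\<^sup>2 - ln (tan u))"
      using ln_tan_at_473 by linarith
  qed (use n in auto)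
  with a show ?thesis by simp
qed

subsection \<open>Motion on the axis\<close>

lemma real_antiderivative_exists:
  fixes f :: "real \<Rightarrow> 'a::euclidean_space"
  assumes "\<And>x. isCont f x"
  obtains F where "\<And>x. (F has_vector_derivative f x) (at x)"
  using einterval_antiderivative[of "-\<infinity>" "\<infinity>" f] assms by auto

text \<open>\<open>M\<close> is the total mass and \<open>r\<close> the common distance of the
  primaries from the origin; the force on the axis depends only on these.\<close>

locale axis_motion =
  fixes M r :: real
  assumes M_pos: "M > 0" and r_pos: "r > 0"
begin

definition freq :: real where "freq = sqrt (M / r ^ 3)"

definition acc :: "real \<Rightarrow> real" where "acc y = M * y / sqrt (r\<^sup>2 + y\<^sup>2) ^ 3"

lemma freq_pos: "freq > 0" and freq_sq: "freq\<^sup>2 = M / r ^ 3"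
  using M_pos r_pos by (simp_all add: freq_def)

lemma radius_le: "r \<le> sqrt (r\<^sup>2 + y\<^sup>2)"
  using r_pos by (simp add: real_le_rsqrt)

lemma radius_pos: "0 < sqrt (r\<^sup>2 + y\<^sup>2)"
  using radius_le[of y] r_pos by linarith

lemma radius_less: "y \<noteq> 0 \<Longrightarrow> r < sqrt (r\<^sup>2 + y\<^sup>2)"
  using r_pos by (simp add: real_less_rsqrt)

lemma mult_acc: "y * acc y = M * y\<^sup>2 / sqrt (r\<^sup>2 + y\<^sup>2) ^ 3"
  by (simp add: acc_def power2_eq_square)

text \<open>Multiplication by \<open>y\<close> avoids sign cases, and \<open>y * acc y\<close> is
  the term that enters the angular velocity of the phase point.\<close>

lemma acc_mult_le: "y * acc y \<le> freq\<^sup>2 * y\<^sup>2"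
proof -
  have "M * y\<^sup>2 / sqrt (r\<^sup>2 + y\<^sup>2) ^ 3 \<le> M * y\<^sup>2 / r ^ 3"
    using M_pos r_pos radius_le[of y] by (intro divide_left_mono power_mono mult_pos_pos zero_less_power radius_pos) auto
  then show ?thesis by (simp add: mult_acc freq_sq)
qed

lemma acc_mult_less:
  assumes "y \<noteq> 0"
  shows "y * acc y < freq\<^sup>2 * y\<^sup>2"
proof -
  have "M * y\<^sup>2 / sqrt (r\<^sup>2 + y\<^sup>2) ^ 3 < M * y\<^sup>2 / r ^ 3"
  proof (rule divide_strict_left_mono)
    show "r ^ 3 < sqrt (r\<^sup>2 + y\<^sup>2) ^ 3"
      using r_pos radius_less[OF assms] by (intro power_strict_mono) auto
    show "0 < M * y\<^sup>2" using M_pos assms by simp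
    show "0 < sqrt (r\<^sup>2 + y\<^sup>2) ^ 3 * r ^ 3"
      by (intro mult_pos_pos zero_less_power radius_pos r_pos)
  qed
  then show ?thesis by (simp add: mult_acc freq_sq)
qed

lemma acc_mult_nonneg: "0 \<le> y * acc y"
  using M_pos by (simp add: mult_acc)

lemma acc_mult_pos: "y \<noteq> 0 \<Longrightarrow> 0 < y * acc y"
  using M_pos radius_pos[of y] by (simp add: mult_acc)

lemma isCont_acc: "isCont acc y"
  unfolding acc_def[abs_def] using radius_pos by (intro continuous_intros) (metis less_irrefl power_not_zero)

section \<open>Conservation of energy and the lower bound for periods\<close>

lemma energy_constant:
  assumes z: "\<And>t. (z has_real_derivative v t) (at t)"
    and v: "\<And>t. (v has_real_derivative - acc (z t)) (at t)"
  shows "(v s)\<^sup>2 / 2 - M / sqrt (r\<^sup>2 + (z s)\<^sup>2) = (v t)\<^sup>2 / 2 - M / sqrt (r\<^sup>2 + (z t)\<^sup>2)"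
proof -
  define S where "S t = sqrt (r\<^sup>2 + (z t)\<^sup>2)" for t
  have S: "S x > 0" for x by (simp only: S_def radius_pos)
  have dS: "(S has_real_derivative z x * v x / S x) (at x)" for x
    unfolding S_def[abs_def] using radius_pos[of "z x"]
    by (auto intro!: derivative_eq_intros z simp: field_simps)
  have "((\<lambda>t. (v t)\<^sup>2 / 2 - M / S t) has_real_derivative 0) (at x)" for x
  proof -
    have "((\<lambda>t. (v t)\<^sup>2 / 2 - M / S t) has_real_derivative
        - v x * acc (z x) + M * (z x * v x / S x) / (S x * S x)) (at x)"
      using S[of x] by (auto intro!: derivative_eq_intros v dS)
    also have "acc (z x) = M * z x / (S x * (S x * S x))"
      unfolding acc_def S_def by (simp only: power3_eq_cube mult.assoc)
    finally show ?thesis by (simp add: ac_simps)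
  qed
  then have "(v s)\<^sup>2 / 2 - M / S s = (v t)\<^sup>2 / 2 - M / S t"
    by (intro DERIV_isconst_all[of "\<lambda>t. (v t)\<^sup>2 / 2 - M / S t"]) auto
  then show ?thesis by (simp add: S_def)
qed

text \<open>Rest at the origin has the least energy, so a solution passing through that state has
  zero velocity at all times. Energy conservation thus takes the place of a uniqueness
  theorem.\<close>

lemma phase_nonzero:
  assumes z: "\<And>t. (z has_real_derivative v t) (at t)"
    and v: "\<And>t. (v has_real_derivative - acc (z t)) (at t)"
    and "\<not> z constant_on UNIV"
  shows "z t \<noteq> 0 \<or> v t \<noteq> 0"
proof (rule ccontr)
  assume "\<not> ?thesis"
  then have 0: "z t = 0" "v t = 0" by auto
  have "v s = 0" for s
  proof -
    have "(v s)\<^sup>2 / 2 - M / sqrt (r\<^sup>2 + (z s)\<^sup>2) = - (M / r)"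
      using energy_constant[OF z v, of s t] r_pos by (simp add: 0)
    then have "(v s)\<^sup>2 / 2 = M / sqrt (r\<^sup>2 + (z s)\<^sup>2) - M / r" by linarith
    also have "\<dots> \<le> 0" using divide_left_mono[OF radius_le[of "z s"], of M] M_pos r_pos radius_pos[of "z s"]
      by (simp del: real_sqrt_gt_0_iff)
    finally show ?thesis by simp
  qed
  then have "\<And>s. (z has_real_derivative 0) (at s)" using z by metis
  then have "z s = z 0" for s using DERIV_isconst_all by blast
  then show False using assms(3) by (auto simp: constant_on_def)
qed

text \<open>
  Pruefer angle: the phase point \<open>v + i freq z\<close> turns with angular velocity at most \<open>freq\<close>,
  strictly less away from \<open>z = 0\<close>, and closes up after one period.
\<close>

lemma period_gt:
  assumes z: "\<And>t. (z has_real_derivative v t) (at t)"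
    and v: "\<And>t. (v has_real_derivative - acc (z t)) (at t)"
    and nc: "\<not> z constant_on UNIV"
    and T: "T > 0" "\<And>t. z (t + T) = z t"
  shows "2 * pi < freq * T"
proof -
  define w where "w t = Complex (v t) (freq * z t)" for t
  define w' where "w' t = Complex (- acc (z t)) (freq * v t)" for t
  have contz: "isCont z t" and contv: "isCont v t" for t
    using z v DERIV_isCont by blast+
  have w0: "w t \<noteq> 0" for t
    using phase_nonzero[OF z v nc, of t] freq_pos by (auto simp: w_def complex_eq_iff)
  have dw: "(w has_vector_derivative w' t) (at t)" for t
    unfolding w_def w'_def has_vector_derivative_complex_iff
    by (auto intro!: derivative_eq_intros z v)
  have "isCont (\<lambda>t. w' t / w t) t" for t
  proof -
    have "isCont w' t"
      unfolding w'_def Complex_eq by (intro continuous_intros contv isCont_o2[OF contz isCont_acc])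
    moreover have "isCont w t" using dw has_vector_derivative_continuous by blast
    ultimately show ?thesis using w0 by (intro continuous_at_within_divide) auto
  qed
  \<comment> \<open>Up to an additive constant, \<open>L\<close> is a continuous logarithm of
    \<open>w\<close> along the solution; its imaginary part is the angle and \<open>g\<close> the
    angular velocity.\<close>
  then obtain L where L: "\<And>t. (L has_vector_derivative w' t / w t) (at t)"
    using real_antiderivative_exists by blast
  have "((\<lambda>t. w t * exp (- L t)) has_vector_derivative 0) (at t)" for t
  proof -
    have "((exp \<circ> (\<lambda>t. - L t)) has_vector_derivative (- (w' t / w t)) * exp (- L t)) (at t)"
      by (rule field_vector_diff_chain_at) (auto intro!: derivative_eq_intros L)
    then have "((\<lambda>t. exp (- L t)) has_vector_derivative (- (w' t / w t)) * exp (- L t)) (at t)"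
      by (simp add: o_def)
    from has_vector_derivative_mult[OF dw this] show ?thesis using w0[of t]
      by (simp add: field_simps)
  qed
  then obtain c where c: "\<And>t. w t * exp (- L t) = c"
    using has_vector_derivative_zero_constant[of UNIV "\<lambda>t. w t * exp (- L t)"] by auto
  define \<phi> where "\<phi> t = Im (L t)" for t
  define g where "g t = freq * ((v t)\<^sup>2 + z t * acc (z t)) / ((v t)\<^sup>2 + freq\<^sup>2 * (z t)\<^sup>2)" for t
  have D: "0 < (v t)\<^sup>2 + freq\<^sup>2 * (z t)\<^sup>2" for t
    using phase_nonzero[OF z v nc, of t] freq_pos
    by (cases "z t = 0") (auto intro: add_nonneg_pos)
  have d\<phi>: "(\<phi> has_real_derivative g t) (at t)" for t
  proof -
    have "(\<phi> has_real_derivative Im (w' t / w t)) (at t)"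
      using bounded_linear.has_vector_derivative[OF bounded_linear_Im L[of t]]
      by (simp add: has_real_derivative_iff_has_vector_derivative \<phi>_def[abs_def])
    also have "Im (w' t / w t) = g t"
      by (simp add: w_def w'_def g_def Im_divide power2_eq_square algebra_simps)
    finally show ?thesis .
  qed
  have g_pos: "0 < g t" for t
  proof -
    have "0 < (v t)\<^sup>2 + z t * acc (z t)"
      using phase_nonzero[OF z v nc, of t] acc_mult_nonneg[of "z t"] acc_mult_pos[of "z t"]
      by (cases "z t = 0") (auto intro: add_nonneg_pos)
    then show ?thesis using D freq_pos by (simp add: g_def)
  qed
  have g_le: "g t \<le> freq" for t
    using D[of t] freq_pos acc_mult_le[of "z t"] by (simp add: g_def pos_divide_le_eq)
  have g_less: "g t < freq" if "z t \<noteq> 0" for t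
    using D[of t] freq_pos acc_mult_less[OF that] by (simp add: g_def pos_divide_less_eq)
  have vT: "v (t + T) = v t" for t
  proof -
    have "((\<lambda>s. z (s + T)) has_real_derivative v (t + T)) (at t)"
      using z[of "t + T"] by (simp only: DERIV_shift)
    then have "(z has_real_derivative v (t + T)) (at t)" by (simp only: T(2))
    then show ?thesis using z by (rule DERIV_unique)
  qed
  obtain t0 where t0: "z t0 \<noteq> 0" using nc by (auto simp: constant_on_def)
  have "w (t0 + T) = w t0" by (simp add: w_def vT T)
  then have "w t0 * exp (- L (t0 + T)) = w t0 * exp (- L t0)" using c[of t0] c[of "t0 + T"] by simp
  then have "exp (- L (t0 + T)) = exp (- L t0)" using w0[of t0] by (simp only: mult_cancel_left) simp
  \<comment> \<open>The increment of \<open>L\<close> over \<open>T\<close> is a multiple of 2 pi i;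
    as the angle increases strictly, it gains at least one full turn.\<close>
  then obtain n :: int where "- L (t0 + T) = - L t0 + of_int (2 * n) * pi * \<i>"
    unfolding exp_eq by blast
  from arg_cong[OF this, of Im] have n: "\<phi> t0 = \<phi> (t0 + T) + 2 * of_int n * pi"
    by (simp add: \<phi>_def)
  have "\<phi> t0 < \<phi> (t0 + T)"
    using T d\<phi> g_pos by (intro DERIV_pos_imp_increasing[where f = \<phi>]) auto
  then have "of_int n * pi < 0" unfolding n by (simp add: mult.commute)
  then have "n < 0" by (simp add: mult_less_0_iff)
  then have "of_int n * pi \<le> (- 1) * pi" by (intro mult_right_mono) auto
  with n have 1: "\<phi> t0 + 2 * pi \<le> \<phi> (t0 + T)" by simp
  \<comment> \<open>\<open>\<psi>\<close> is the lag behind uniform rotation at velocity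
    \<open>freq\<close>. It never decreases and grows strictly at \<open>t0\<close>, which makes the
    final inequality strict.\<close>
  define \<psi> where "\<psi> t = freq * t - \<phi> t" for t
  have d\<psi>: "(\<psi> has_real_derivative freq - g t) (at t)" for t
    unfolding \<psi>_def[abs_def] by (auto intro!: derivative_eq_intros d\<phi>)
  obtain d where d: "d > 0" "\<And>h. 0 < h \<Longrightarrow> h < d \<Longrightarrow> \<psi> t0 < \<psi> (t0 + h)"
    using DERIV_pos_inc_right[OF d\<psi>[of t0]] g_less[OF t0] by auto
  define h where "h = min (d / 2) T"
  have "\<psi> t0 < \<psi> (t0 + h)" using d T by (simp add: h_def)
  also have "\<psi> (t0 + h) \<le> \<psi> (t0 + T)"
  proof (rule DERIV_nonneg_imp_nondecreasing[where f = \<psi>])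
    show "\<exists>y. (\<psi> has_real_derivative y) (at t) \<and> 0 \<le> y" for t
      using d\<psi>[of t] g_le[of t] by (metis diff_ge_0_iff_ge)
  qed (simp add: h_def)
  finally have "\<phi> (t0 + T) < \<phi> t0 + freq * T" by (simp add: \<psi>_def algebra_simps)
  with 1 show ?thesis by simp
qed

section \<open>Oscillations of prescribed amplitude and their periods\<close>

definition dist_at :: "real \<Rightarrow> real \<Rightarrow> real" where
  "dist_at a x = sqrt (r\<^sup>2 + (a * sin x)\<^sup>2)"

text \<open>With \<open>A = dist_at a x\<close> and \<open>B = sqrt (r^2 + a^2)\<close>,
  conservation of energy gives \<open>v^2 = 2 * M * (1/A - 1/B)\<close>. Since
  \<open>(a * cos x)^2 = B^2 - A^2\<close>, the quotient \<open>(a * cos x)^2 / v^2\<close> reduces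
  to this product.\<close>

definition rate_sq :: "real \<Rightarrow> real \<Rightarrow> real" where
  "rate_sq a x = dist_at a x * sqrt (r\<^sup>2 + a\<^sup>2) * (dist_at a x + sqrt (r\<^sup>2 + a\<^sup>2)) / (2 * M)"

text \<open>
  Substituting \<open>z = a sin \<theta>\<close> into the energy equation turns the turning points into regular
  points: \<open>(dt/d\<theta>)\<^sup>2 = rate_sq a \<theta>\<close> is smooth and positive.
\<close>

definition rate :: "real \<Rightarrow> real \<Rightarrow> real" where
  "rate a x = sqrt (rate_sq a x)"

lemma dist_at_ge: "r \<le> dist_at a x" and dist_at_pos: "0 < dist_at a x"
  using radius_le radius_pos by (simp_all only: dist_at_def)

lemma rate_sq_pos: "0 < rate_sq a x"
  unfolding rate_sq_def using M_pos
  by (intro divide_pos_pos mult_pos_pos add_pos_pos dist_at_pos radius_pos) auto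

lemma rate_pos: "0 < rate a x"
  using rate_sq_pos by (simp add: rate_def)

lemma continuous_on_rate: "continuous_on S (\<lambda>p. rate (fst p) (snd p))"
  unfolding rate_def rate_sq_def dist_at_def using M_pos by (intro continuous_intros) auto

lemma isCont_rate: "isCont (rate a) x"
  unfolding rate_def rate_sq_def dist_at_def using M_pos by (intro continuous_intros) auto

text \<open>Linear growth in the amplitude makes the periods unbounded.\<close>

lemma rate_ge:
  assumes "0 \<le> a"
  shows "a * sqrt (r / (2 * M)) \<le> rate a x"
proof -
  let ?B = "sqrt (r\<^sup>2 + a\<^sup>2)"
  have "r * a\<^sup>2 \<le> dist_at a x * (r\<^sup>2 + a\<^sup>2)"
    using dist_at_ge[of a x] r_pos by (intro mult_mono) auto
  also have "\<dots> = dist_at a x * ?B * ?B" by simp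
  also have "\<dots> \<le> dist_at a x * ?B * (dist_at a x + ?B)"
    using dist_at_pos[of a x] by (intro mult_left_mono) auto
  finally have "r * a\<^sup>2 / (2 * M) \<le> rate_sq a x"
    unfolding rate_sq_def using M_pos by (intro divide_right_mono) auto
  then have "sqrt (r * a\<^sup>2 / (2 * M)) \<le> rate a x" by (simp add: rate_def)
  moreover have "sqrt (r * a\<^sup>2 / (2 * M)) = a * sqrt (r / (2 * M))"
    using assms by (simp add: real_sqrt_mult real_sqrt_divide)
  ultimately show ?thesis by simp
qed

lemma rate_lower: "r * sqrt (r / M) \<le> rate a x"
proof -
  let ?B = "sqrt (r\<^sup>2 + a\<^sup>2)"
  have "r * r * (r + r) \<le> dist_at a x * ?B * (dist_at a x + ?B)"
    using dist_at_ge[of a x] radius_le[of a] r_pos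
    by (intro mult_mono add_mono mult_nonneg_nonneg add_nonneg_nonneg) auto
  then have "r * r * (r + r) / (2 * M) \<le> rate_sq a x"
    unfolding rate_sq_def using M_pos by (intro divide_right_mono) auto
  then have "sqrt (r * r * (r + r) / (2 * M)) \<le> rate a x" by (simp add: rate_def)
  moreover have "r * r * (r + r) / (2 * M) = r\<^sup>2 * (r / M)" using M_pos
    by (simp add: field_simps power2_eq_square)
  then have "sqrt (r * r * (r + r) / (2 * M)) = r * sqrt (r / M)"
    using r_pos by (simp only: real_sqrt_mult real_sqrt_abs abs_of_pos)
  ultimately show ?thesis by simp
qed

text \<open>Amplitude zero is no oscillation, but it extends \<open>period\<close> continuously to
  \<open>2 * pi / freq\<close>, the lower end for the intermediate value theorem.\<close>

lemma rate_zero: "rate 0 x = 1 / freq"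
  using r_pos M_pos
  by (simp add: rate_def rate_sq_def dist_at_def freq_def real_sqrt_divide eval_nat_numeral)

definition period :: "real \<Rightarrow> real" where
  "period a = integral {0..2*pi} (rate a)"

lemma continuous_on_period: "continuous_on S period"
proof -
  have "continuous_on S (\<lambda>a. integral (cbox 0 (2*pi)) (rate a))"
    by (rule integral_continuous_on_param)
      (use continuous_on_rate in \<open>auto simp: case_prod_unfold\<close>)
  then show ?thesis by (simp add: period_def[abs_def])
qed

lemma rate_integrable: "rate a integrable_on {x..y}"
  using isCont_rate by (intro integrable_continuous_real continuous_at_imp_continuous_on) auto

lemma period_attained:
  assumes "2 * pi < freq * T"
  obtains a where "a > 0" "period a = T"
proof -
  have T: "period 0 < T"
    using assms freq_pos by (simp add: period_def rate_zero[abs_def] field_simps)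
  \<comment> \<open>At this amplitude the bound of \<open>rate_ge\<close> integrates to exactly
    \<open>T\<close>.\<close>
  define a1 where "a1 = T / (2 * pi) / sqrt (r / (2 * M))"
  have c: "sqrt (r / (2 * M)) > 0" using r_pos M_pos by simp
  have "0 < T" using assms freq_pos by (smt (verit) pi_gt_zero zero_less_mult_iff)
  then have a1: "a1 > 0" using c by (simp add: a1_def del: real_sqrt_gt_0_iff)
  have "T = integral {0..2*pi} (\<lambda>x. a1 * sqrt (r / (2 * M)))"
    using r_pos M_pos by (simp add: a1_def)
  also have "\<dots> \<le> period a1"
    unfolding period_def using rate_ge[of a1] a1
    by (intro integral_le rate_integrable) auto
  finally obtain a where a: "0 \<le> a" "a \<le> a1" "period a = T"
    using IVT'[of period 0 T a1] T a1 continuous_on_period by auto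
  moreover from this have "a \<noteq> 0" using T by auto
  ultimately show ?thesis by (intro that[of a]) auto
qed

lemma rate_deriv:
  "(rate a has_real_derivative
     (a\<^sup>2 * sin x * cos x / dist_at a x) * (sqrt (r\<^sup>2 + a\<^sup>2) * (2 * dist_at a x + sqrt (r\<^sup>2 + a\<^sup>2)) / (2 * M))
      / (2 * rate a x)) (at x)"
proof -
  have dA: "(dist_at a has_real_derivative a\<^sup>2 * sin x * cos x / dist_at a x) (at x)"
    unfolding dist_at_def[abs_def] using radius_pos[of "a * sin x"]
    by (auto intro!: derivative_eq_intros simp: field_simps power2_eq_square)
  have "(rate_sq a has_real_derivative
     (a\<^sup>2 * sin x * cos x / dist_at a x) * (sqrt (r\<^sup>2 + a\<^sup>2) * (2 * dist_at a x + sqrt (r\<^sup>2 + a\<^sup>2)) / (2 * M))) (at x)"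
  proof -
    obtain B where B: "sqrt (r\<^sup>2 + a\<^sup>2) = B" by blast
    obtain p where p: "a\<^sup>2 * sin x * cos x / dist_at a x = p" by blast
    have "((\<lambda>x. dist_at a x * B * (dist_at a x + B) / (2 * M)) has_real_derivative
        (p * B * (dist_at a x + B) + p * (dist_at a x * B)) / (2 * M)) (at x)"
      by (rule DERIV_cdivide) (auto intro!: derivative_eq_intros dA[unfolded p])
    moreover have "(p * B * (dist_at a x + B) + p * (dist_at a x * B)) / (2 * M)
        = p * (B * (2 * dist_at a x + B) / (2 * M))"
      by (simp add: algebra_simps flip: add_divide_distrib)
    ultimately show ?thesis unfolding rate_sq_def[abs_def] B p by simp
  qed
  from DERIV_chain2[OF DERIV_real_sqrt[OF rate_sq_pos] this]
  show ?thesis unfolding rate_def[abs_def] by (simp add: field_simps)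
qed

text \<open>The left side is the second time derivative of \<open>a * sin x\<close> when
  \<open>x\<close> moves with velocity \<open>1 / rate a x\<close>, so this is the equation of
  motion.\<close>

lemma rate_acceleration:
  "(- a * sin x * rate a x - a * cos x * ((a\<^sup>2 * sin x * cos x / dist_at a x) *
      (sqrt (r\<^sup>2 + a\<^sup>2) * (2 * dist_at a x + sqrt (r\<^sup>2 + a\<^sup>2)) / (2 * M)) / (2 * rate a x)))
    / (rate a x)\<^sup>2 / rate a x = - acc (a * sin x)"
proof -
  define A B q s where "A = dist_at a x" and "B = sqrt (r\<^sup>2 + a\<^sup>2)" and "q = rate_sq a x" and "s = rate a x"
  have p: "A > 0" "B > 0" "q > 0" "s > 0"
    by (simp_all only: A_def B_def q_def s_def dist_at_pos radius_pos rate_sq_pos rate_pos)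
  have q: "q = A * B * (A + B) / (2 * M)" by (simp add: q_def rate_sq_def A_def B_def)
  have s: "s\<^sup>2 = q" using p by (simp add: s_def rate_def q_def)
  \<comment> \<open>This eliminates the cosine; together with \<open>s^2 = q\<close> it leaves
    algebra in \<open>A\<close>, \<open>B\<close> and \<open>M\<close>.\<close>
  have AB: "a\<^sup>2 * (cos x)\<^sup>2 = B\<^sup>2 - A\<^sup>2"
    using r_pos by (simp add: A_def B_def dist_at_def cos_squared_eq power_mult_distrib algebra_simps)
  have "(- a * sin x * s - a * cos x * ((a\<^sup>2 * sin x * cos x / A) * (B * (2 * A + B) / (2 * M)) / (2 * s))) / s\<^sup>2 / s
    = - a * sin x * (1 / s\<^sup>2 + (a\<^sup>2 * (cos x)\<^sup>2) * (B * (2 * A + B)) / (4 * M * A * (s\<^sup>2)\<^sup>2))"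
    using p M_pos by (simp add: field_simps power2_eq_square)
  also have "\<dots> = - a * sin x * (1 / q + (B\<^sup>2 - A\<^sup>2) * (B * (2 * A + B)) / (4 * M * A * q\<^sup>2))"
    by (simp only: s AB)
  also have "1 / q + (B\<^sup>2 - A\<^sup>2) * (B * (2 * A + B)) / (4 * M * A * q\<^sup>2) = M / A ^ 3"
  proof -
    have "A + B > 0" using p by simp
    have "(B\<^sup>2 - A\<^sup>2) * (B * (2 * A + B)) / (4 * M * A * q\<^sup>2)
      = ((A + B) * (B - A)) * (B * (2 * A + B)) / (4 * M * A * (A * B * (A + B) / (2 * M))\<^sup>2)"
      by (simp add: q power2_eq_square algebra_simps)
    also have "\<dots> = M * (B - A) * (2 * A + B) / (A ^ 3 * B * (A + B))"
      using p M_pos \<open>A + B > 0\<close> by (simp add: divide_simps power2_eq_square power3_eq_cube)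
    finally have 1: "(B\<^sup>2 - A\<^sup>2) * (B * (2 * A + B)) / (4 * M * A * q\<^sup>2)
      = M * (B - A) * (2 * A + B) / (A ^ 3 * B * (A + B))" .
    have 2: "1 / q = M * (2 * A\<^sup>2) / (A ^ 3 * B * (A + B))"
      using p M_pos \<open>A + B > 0\<close> by (simp add: q divide_simps power2_eq_square power3_eq_cube)
    have "M * (2 * A\<^sup>2) + M * (B - A) * (2 * A + B) = M * (B * (A + B))"
      by (simp add: algebra_simps power2_eq_square)
    then have "1 / q + (B\<^sup>2 - A\<^sup>2) * (B * (2 * A + B)) / (4 * M * A * q\<^sup>2)
      = M * (B * (A + B)) / (A ^ 3 * (B * (A + B)))"
      unfolding 1 2 by (simp only: add_divide_distrib[symmetric] mult.assoc)
    then show ?thesis using p \<open>A + B > 0\<close> by simp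
  qed
  also have "- a * sin x * (M / A ^ 3) = - acc (a * sin x)"
    by (simp add: acc_def A_def dist_at_def)
  finally show ?thesis by (simp only: A_def B_def s_def)
qed

text \<open>Integrating \<open>rate a\<close> gives the time \<open>H\<close> as a function of the
  angle; its inverse \<open>\<phi>\<close> gives the motion
  \<open>z = a * sin \<phi>\<close>.\<close>

lemma oscillation_exists:
  assumes "2 * pi < freq * T"
  obtains z v where "\<And>t. (z has_real_derivative v t) (at t)"
    "\<And>t. (v has_real_derivative - acc (z t)) (at t)"
    "\<not> z constant_on UNIV" "minimal_period z T"
proof -
  obtain a where a: "a > 0" "period a = T" using period_attained[OF assms] by blast
  obtain H0 where H0: "\<And>x. (H0 has_vector_derivative rate a x) (at x)"
    using real_antiderivative_exists[of "rate a"] isCont_rate by blast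
  define H where "H x = H0 x - H0 0" for x
  have dH: "(H has_real_derivative rate a x) (at x)" for x
    unfolding H_def[abs_def] has_real_derivative_iff_has_vector_derivative
    by (auto intro!: derivative_eq_intros H0)
  have H_mono: "H x < H y" if "x < y" for x y
    using that dH rate_pos by (intro DERIV_pos_imp_increasing[where f = H]) auto
  then have H_mono_iff: "H x < H y \<longleftrightarrow> x < y" for x y by (metis not_less_iff_gr_or_eq)
  have "H 0 = 0" by (simp add: H_def)
  have "(rate a has_integral H (2*pi) - H 0) {0..2*pi}"
    by (rule fundamental_theorem_of_calculus)
      (use dH in \<open>auto simp: has_real_derivative_iff_has_vector_derivative intro: has_vector_derivative_at_within\<close>)
  then have H2pi: "H (2*pi) = T" using a \<open>H 0 = 0\<close> by (auto simp: period_def integral_unique)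
  have H_period: "H (x + 2*pi) = H x + T" for x
  proof -
    have "((\<lambda>x. H (x + 2*pi) - H x) has_real_derivative 0) (at x)" for x
    proof -
      have "((\<lambda>x. H (x + 2*pi)) has_real_derivative rate a (x + 2*pi)) (at x)"
        using dH[of "x + 2*pi"] by (simp only: DERIV_shift)
      moreover have "rate a (x + 2*pi) = rate a x" by (simp add: rate_def rate_sq_def dist_at_def)
      ultimately show ?thesis using DERIV_diff[OF _ dH] by fastforce
    qed
    then have "H (x + 2*pi) - H x = H (0 + 2*pi) - H 0"
      by (intro DERIV_isconst_all[of "\<lambda>x. H (x + 2*pi) - H x"]) auto
    then show ?thesis by (simp add: H2pi \<open>H 0 = 0\<close>)
  qed
  have H_cont: "isCont H x" for x using dH DERIV_isCont by blast
  define c where "c = r * sqrt (r / M)"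
  have c: "c > 0" using r_pos M_pos by (simp add: c_def)
  have H_lin: "c * (y - x) \<le> H y - H x" if "x \<le> y" for x y
  proof -
    have "H x - c * x \<le> H y - c * y"
    proof (rule DERIV_nonneg_imp_nondecreasing[where f = "\<lambda>x. H x - c * x"])
      fix t show "\<exists>d. ((\<lambda>x. H x - c * x) has_real_derivative d) (at t) \<and> 0 \<le> d"
        using rate_lower[of a t]
        by (intro exI[of _ "rate a t - c"]) (auto intro!: derivative_eq_intros dH simp: c_def)
    qed (rule that)
    then show ?thesis by (simp add: algebra_simps)
  qed
  have "\<exists>x. H x = t" for t
  proof -
    \<comment> \<open>\<open>H\<close> has slope at least \<open>c\<close>, so \<open>t\<close> lies
      between its values at \<open>- y\<close> and \<open>y\<close>.\<close>
    define y where "y = \<bar>t\<bar> / c"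
    have y: "y \<ge> 0" "c * y = \<bar>t\<bar>" using c by (auto simp: y_def)
    have "H (- y) \<le> t" "t \<le> H y"
      using H_lin[of "- y" 0] H_lin[of 0 y] y \<open>H 0 = 0\<close> by auto
    moreover have "continuous_on {- y..y} H"
      using H_cont by (intro continuous_at_imp_continuous_on) auto
    ultimately show ?thesis using IVT'[of H "- y" t y] y by auto
  qed
  then obtain \<phi> where H\<phi>: "\<And>t. H (\<phi> t) = t" by metis
  have \<phi>H: "\<phi> (H x) = x" for x using H\<phi>[of "H x"] H_mono_iff by (metis not_less_iff_gr_or_eq)
  have \<phi>_mono: "\<phi> s < \<phi> t \<longleftrightarrow> s < t" for s t using H_mono_iff[of "\<phi> s" "\<phi> t"] by (simp add: H\<phi>)
  have \<phi>_period: "\<phi> (t + T) = \<phi> t + 2*pi" for t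
    using \<phi>H[of "\<phi> t + 2*pi"] by (simp add: H_period H\<phi>)
  have d\<phi>: "(\<phi> has_real_derivative 1 / rate a (\<phi> t)) (at t)" for t
  proof -
    have "isCont \<phi> (H (\<phi> t))"
      by (rule isCont_inverse_function[of 1]) (use \<phi>H H_cont in auto)
    then have "isCont \<phi> t" by (simp only: H\<phi>)
    then show ?thesis
      using DERIV_inverse_function[where f = H and g = \<phi> and x = t and a = "t - 1" and b = "t + 1"] dH rate_pos[of a "\<phi> t"] H\<phi>
      by (simp add: inverse_eq_divide)
  qed
  define z v where "z t = a * sin (\<phi> t)" and "v t = a * cos (\<phi> t) / rate a (\<phi> t)" for t
  have dz: "(z has_real_derivative v t) (at t)" for t
    unfolding z_def[abs_def] v_def by (auto intro!: derivative_eq_intros d\<phi>)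
  have dv: "(v has_real_derivative - acc (z t)) (at t)" for t
  proof -
    define x where "x = \<phi> t"
    have "((\<lambda>x. a * cos x / rate a x) has_real_derivative (- a * sin x * rate a x - a * cos x * ((a\<^sup>2 * sin x * cos x / dist_at a x) *
      (sqrt (r\<^sup>2 + a\<^sup>2) * (2 * dist_at a x + sqrt (r\<^sup>2 + a\<^sup>2)) / (2 * M)) / (2 * rate a x)))
        / (rate a x)\<^sup>2) (at x)"
      using rate_pos[of a x]
      by (auto intro!: derivative_eq_intros rate_deriv simp: power2_eq_square)
    from DERIV_chain2[OF this[unfolded x_def] d\<phi>]
    show ?thesis using rate_acceleration[of a "\<phi> t"] by (simp add: v_def[abs_def] z_def)
  qed
  have T: "0 < T" using H_mono[of 0 "2*pi"] H2pi \<open>H 0 = 0\<close> by simp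
  \<comment> \<open>A time of maximal height: a period shorter than \<open>T\<close> would put
    another maximum at an angle less than one full turn after \<open>pi / 2\<close>.\<close>
  define t1 where "t1 = H (pi/2)"
  have t1: "\<phi> t1 = pi/2" by (simp add: t1_def \<phi>H)
  have "minimal_period z T"
    unfolding minimal_period_def
  proof (intro conjI allI impI notI T)
    show "z (t + T) = z t" for t by (simp add: z_def \<phi>_period)
    fix S assume S: "0 < S \<and> S < T" and per: "\<forall>t. z (t + S) = z t"
    define y where "y = \<phi> (t1 + S) - pi/2"
    have "sin (\<phi> (t1 + S)) = 1" using per[rule_format, of t1] a by (simp add: z_def t1)
    then have "cos y = 1" by (simp add: y_def cos_diff)
    moreover have y: "0 < y" "y < 2*pi"
      using \<phi>_mono[of t1 "t1 + S"] \<phi>_mono[of "t1 + S" "t1 + T"] S by (auto simp: y_def t1 \<phi>_period)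
    ultimately obtain k :: int where "y = k * (2 * pi)" by (auto simp: cos_one_2pi_int)
    with y have "0 < real_of_int k * (2*pi)" "real_of_int k * (2*pi) < 1 * (2*pi)" by auto
    then have "0 < real_of_int k" "real_of_int k < 1" by (simp_all add: zero_less_mult_iff)
    then show False by simp
  qed
  moreover have "\<not> z constant_on UNIV"
  proof
    assume "z constant_on UNIV"
    then have "z t1 = z 0" by (auto simp: constant_on_def)
    moreover have "\<phi> 0 = 0" using \<phi>H[of 0] \<open>H 0 = 0\<close> by simp
    ultimately show False using a by (simp add: z_def t1)
  qed
  ultimately show ?thesis using that dz dv by blast
qed

lemma period_condition_iff:
  "(\<exists>z v. (\<forall>t. (z has_real_derivative v t) (at t) \<and> (v has_real_derivative - acc (z t)) (at t)) \<and>
      \<not> z constant_on UNIV \<and> minimal_period z T) \<longleftrightarrow> 2 * pi < freq * T" (is "?L \<longleftrightarrow> _")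
proof
  assume ?L
  then obtain z v where "\<And>t. (z has_real_derivative v t) (at t)"
    "\<And>t. (v has_real_derivative - acc (z t)) (at t)"
    "\<not> z constant_on UNIV" "minimal_period z T" by blast
  then show "2 * pi < freq * T" using period_gt[of z v T] unfolding minimal_period_def by blast
next
  assume T: "2 * pi < freq * T"
  obtain z v where "\<And>t. (z has_real_derivative v t) (at t)"
    "\<And>t. (v has_real_derivative - acc (z t)) (at t)"
    "\<not> z constant_on UNIV" "minimal_period z T" by (rule oscillation_exists[OF T]) (rule that)
  then show ?L by (intro exI[of _ z] exI[of _ v]) simp
qed

end

subsection \<open>The regular polygon\<close>

text \<open>For \<open>N s = norm (x - s *\<^sub>R y)\<close>, the product of \<open>N\<close> and
  its derivative at 1 is \<open>(norm y)^2 - x \<bullet> y\<close>. Equal norms make this half of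
  \<open>(N 1)^2\<close>, so only the distance enters.\<close>

lemma inverse_dist_radial_deriv:
  fixes x y :: "'a::real_inner"
  assumes "norm x = norm y" "x \<noteq> y"
  shows "((\<lambda>s. 1 / norm (x - s *\<^sub>R y)) has_real_derivative - 1 / (2 * norm (x - y))) (at 1)"
proof -
  define N where "N s = norm (x - s *\<^sub>R y)" for s
  have N2: "N s = sqrt ((norm y)\<^sup>2 * (1 + s\<^sup>2) - 2 * s * (x \<bullet> y))" for s
  proof -
    have "x \<bullet> x = y \<bullet> y" using assms(1) by (simp add: norm_eq_sqrt_inner)
    moreover have "(N s)\<^sup>2 = (x - s *\<^sub>R y) \<bullet> (x - s *\<^sub>R y)"
      by (simp add: N_def power2_norm_eq_inner)
    ultimately have "(N s)\<^sup>2 = (y \<bullet> y) * (1 + s\<^sup>2) - 2 * s * (x \<bullet> y)"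
      by (simp add: inner_diff_left inner_diff_right inner_commute power2_eq_square algebra_simps)
    then have "(N s)\<^sup>2 = (norm y)\<^sup>2 * (1 + s\<^sup>2) - 2 * s * (x \<bullet> y)"
      by (simp only: power2_norm_eq_inner)
    then show ?thesis by (metis N_def norm_ge_zero real_sqrt_unique)
  qed
  have N1: "N 1 > 0" using assms(2) by (simp add: N_def)
  then have p: "(norm y)\<^sup>2 * (1 + 1\<^sup>2) - 2 * 1 * (x \<bullet> y) > 0" by (simp add: N2)
  have "((\<lambda>s. c * (1 + s\<^sup>2) - 2 * s * b) has_real_derivative c * 2 - 2 * b) (at 1)" for b c :: real
    by (auto intro!: derivative_eq_intros)
  from DERIV_chain2[OF DERIV_real_sqrt[OF p] this]
  have "(N has_real_derivative inverse (N 1) / 2 * ((norm y)\<^sup>2 * 2 - 2 * (x \<bullet> y))) (at 1)"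
    by (simp only: N2[symmetric])
  moreover have "(norm y)\<^sup>2 * 2 - 2 * (x \<bullet> y) = (N 1)\<^sup>2" using p by (simp add: N2)
  ultimately have "(N has_real_derivative N 1 / 2) (at 1)" using N1
    by (simp add: power2_eq_square flip: mult.assoc)
  then have "((\<lambda>s. 1 / N s) has_real_derivative - 1 / (2 * N 1)) (at 1)"
    using N1 by (auto intro!: derivative_eq_intros simp: power2_eq_square)
  then show ?thesis by (simp add: N_def)
qed

text \<open>Only pairs containing \<open>j\<close> vary with \<open>s\<close>; each is covered by
  the derivative of the inverse distance.\<close>

lemma newton_potential_radial_deriv:
  assumes inj: "inj_on q {1..n}" and norm: "\<And>i. i \<in> {1..n} \<Longrightarrow> norm (q i) = r"
    and j: "j \<in> {1..n}"
  shows "((\<lambda>s. newton_potential n m (q(j := s *\<^sub>R q j))) has_real_derivative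
     - (\<Sum>i\<in>{1..n} - {j}. m i * m j / (2 * norm (q i - q j)))) (at 1)"
proof -
  let ?P = "{(i, k). 1 \<le> i \<and> i < k \<and> k \<le> n}"
  define d where "d = (\<lambda>(i, k). if i = j \<or> k = j then - (m i * m k / (2 * norm (q i - q k))) else 0)"
  have fin: "finite ?P" by (rule finite_subset[of _ "{1..n} \<times> {1..n}"]) auto
  have d: "((\<lambda>s. case e of (i, k) \<Rightarrow> m i * m k / norm ((q(j := s *\<^sub>R q j)) i - (q(j := s *\<^sub>R q j)) k))
      has_real_derivative d e) (at 1)" if "e \<in> ?P" for e
  proof -
    obtain i k where e: "e = (i, k)" by (cases e)
    have ik: "i \<in> {1..n}" "k \<in> {1..n}" "i \<noteq> k" using that e by auto
    then have qik: "q i \<noteq> q k" using inj by (auto dest: inj_onD)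
    consider "i = j" | "k = j" | "i \<noteq> j" "k \<noteq> j" by blast
    then show ?thesis
    proof cases
      case 1
      have "((\<lambda>s. m i * m k * (1 / norm (q k - s *\<^sub>R q j))) has_real_derivative
          m i * m k * (- 1 / (2 * norm (q k - q j)))) (at 1)"
        using 1 ik qik norm by (intro DERIV_cmult inverse_dist_radial_deriv) auto
      then show ?thesis using 1 ik by (simp add: e d_def norm_minus_commute)
    next
      case 2
      have "((\<lambda>s. m i * m k * (1 / norm (q i - s *\<^sub>R q j))) has_real_derivative
          m i * m k * (- 1 / (2 * norm (q i - q j)))) (at 1)"
        using 2 ik qik norm by (intro DERIV_cmult inverse_dist_radial_deriv) auto
      then show ?thesis using 2 ik by (simp add: e d_def)
    next
      case 3
      then show ?thesis by (simp add: e d_def)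
    qed
  qed
  have "((\<lambda>s. newton_potential n m (q(j := s *\<^sub>R q j))) has_real_derivative sum d ?P) (at 1)"
    unfolding newton_potential_def by (rule DERIV_sum) (rule d)
  also have "sum d ?P = sum d {e \<in> ?P. fst e = j \<or> snd e = j}"
    by (rule sum.mono_neutral_right[OF fin]) (auto simp: d_def split: if_splits)
  also have "\<dots> = (\<Sum>i\<in>{1..n} - {j}. - (m i * m j / (2 * norm (q i - q j))))"
    by (rule sum.reindex_bij_witness[of _ "\<lambda>i. if i < j then (i, j) else (j, i)"
          "\<lambda>e. if fst e = j then snd e else fst e"])
      (use j in \<open>auto simp: d_def norm_minus_commute mult.commute split: if_splits\<close>)
  finally show ?thesis by (simp only: sum_negf)
qed

text \<open>One vertex is enough to determine the multiplier; \<open>j\<close> is whichever label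
  sits at the vertex \<open>k = 0\<close>.\<close>

lemma regular_polygonE:
  assumes "regular_polygon n q" "n \<ge> 2"
  obtains r j where "r > 0" "j \<in> {1..n}" "\<And>i. i \<in> {1..n} \<Longrightarrow> norm (q i) = r"
    "q j $ 1 \<noteq> 0 \<or> q j $ 2 \<noteq> 0"
    "(\<Sum>i\<in>{1..n} - {j}. 1 / norm (q i - q j)) = csc_sum n / (2 * r)"
proof -
  obtain r phi where r: "r > 0" and bij: "bij_betw q {1..n}
        ((\<lambda>k. vector [r * cos (phi + 2 * pi * real k / real n),
                      r * sin (phi + 2 * pi * real k / real n), 0]) ` {..<n})"
    using assms(1) unfolding regular_polygon_def by blast
  define p :: "nat \<Rightarrow> real ^ 3" where "p k = vector [r * cos (phi + 2 * pi * real k / real n),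
                      r * sin (phi + 2 * pi * real k / real n), 0]" for k
  have bij: "bij_betw q {1..n} (p ` {..<n})" using bij by (simp only: p_def[abs_def])
  \<comment> \<open>Distinctness of the vertices follows by counting: the bijection \<open>q\<close>
    forces \<open>p\<close> to take \<open>n\<close> values.\<close>
  have "card (p ` {..<n}) = n" using bij_betw_same_card[OF bij] by simp
  then have inj: "inj_on p {..<n}" by (intro eq_card_imp_inj_on) auto
  have norm_p: "norm (p k) = r" for k
    using r by (simp add: norm_vec_def L2_set_def sum_3 p_def power_mult_distrib flip: distrib_left)
  have dist_p: "norm (p k - p 0) = 2 * r * sin (pi * real k / real n)" if "k < n" for k
  proof -
    define t where "t = pi * real k / real n"
    have t: "phi + 2 * pi * real k / real n = phi + 2 * t" by (simp add: t_def)
    have "sin t \<ge> 0" unfolding t_def using that by (intro sin_ge_zero) (auto simp: field_simps)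
    have "(norm (p k - p 0))\<^sup>2 = (r * cos (phi + 2 * t) - r * cos phi)\<^sup>2 + (r * sin (phi + 2 * t) - r * sin phi)\<^sup>2"
      by (simp add: norm_vec_def L2_set_def sum_3 p_def t)
    also have "\<dots> = r\<^sup>2 * ((cos (phi + 2 * t))\<^sup>2 + (sin (phi + 2 * t))\<^sup>2 + ((cos phi)\<^sup>2 + (sin phi)\<^sup>2)
        - 2 * (cos (phi + 2 * t) * cos phi + sin (phi + 2 * t) * sin phi))"
    proof -
      have "(r * a - r * c)\<^sup>2 + (r * b - r * d)\<^sup>2 = r\<^sup>2 * (a\<^sup>2 + b\<^sup>2 + (c\<^sup>2 + d\<^sup>2) - 2 * (a * c + b * d))" for a b c d
        by (simp add: power2_eq_square algebra_simps)
      then show ?thesis .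
    qed
    also have "\<dots> = r\<^sup>2 * (2 - 2 * cos (2 * t))"
    proof -
      have "cos (phi + 2 * t) * cos phi + sin (phi + 2 * t) * sin phi = cos (2 * t)"
        using cos_diff[of "phi + 2 * t" phi] by simp
      then show ?thesis by (simp only: sin_cos_squared_add2) simp
    qed
    also have "\<dots> = (2 * r * sin t)\<^sup>2"
      by (simp add: cos_double_sin power2_eq_square)
    finally show ?thesis unfolding t_def[symmetric] using r \<open>sin t \<ge> 0\<close>
      by (intro power2_eq_imp_eq[of _ "2 * r * sin t"]) auto
  qed
  obtain j where j: "j \<in> {1..n}" "q j = p 0"
    using bij assms(2) by (metis bij_betw_iff_bijections imageI lessThan_iff less_le_trans pos2)
  have "bij_betw q ({1..n} - {j}) (p ` {..<n} - {p 0})"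
    using bij_betw_DiffI[OF bij, of "{j}" "{p 0}"] j by (auto simp: bij_betw_def)
  moreover have "p ` {..<n} - {p 0} = p ` {1..<n}"
  proof -
    have "{..<n} = insert 0 {1..<n}" using assms(2) by auto
    moreover have "p 0 \<notin> p ` {1..<n}" using inj assms(2) by (auto dest: inj_onD)
    ultimately show ?thesis by auto
  qed
  ultimately have bij': "bij_betw q ({1..n} - {j}) (p ` {1..<n})" by simp
  have inj': "inj_on p {1..<n}" by (rule inj_on_subset[OF inj]) auto
  have "(\<Sum>i\<in>{1..n} - {j}. 1 / norm (q i - q j)) = (\<Sum>y\<in>p ` {1..<n}. 1 / norm (y - p 0))"
    using sum.reindex_bij_betw[OF bij', of "\<lambda>y. 1 / norm (y - p 0)"] j by simp
  also have "\<dots> = (\<Sum>k=1..<n. 1 / norm (p k - p 0))"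
    by (simp only: o_def sum.reindex[OF inj'])
  also have "\<dots> = (\<Sum>k=1..<n. 1 / (2 * r) * (1 / sin (pi * real k / real n)))"
    by (rule sum.cong) (auto simp: dist_p)
  also have "\<dots> = csc_sum n / (2 * r)"
    unfolding csc_sum_def sum_distrib_left[symmetric] by simp
  finally have "(\<Sum>i\<in>{1..n} - {j}. 1 / norm (q i - q j)) = csc_sum n / (2 * r)" .
  moreover have "norm (q i) = r" if i: "i \<in> {1..n}" for i
  proof -
    have "q i \<in> p ` {..<n}" using bij_betwE[OF bij] i by (rule bspec)
    then obtain k where "q i = p k" by (rule imageE)
    then show ?thesis by (simp only: norm_p)
  qed
  moreover have "cos phi \<noteq> 0 \<or> sin phi \<noteq> 0"
    by (metis sin_cos_squared_add power_zero_numeral add_0 zero_neq_one)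
  then have "q j $ 1 \<noteq> 0 \<or> q j $ 2 \<noteq> 0" using r by (simp add: j p_def)
  ultimately show ?thesis using that[OF r j(1)] by blast
qed

text \<open>The inner product of the gradient equation with \<open>q j\<close> extracts its radial
  component, which the chain rule along the ray through \<open>q j\<close> evaluates.\<close>

lemma central_configuration_multiplier:
  assumes cc: "central_configuration n m q lam"
    and norm: "\<And>i. i \<in> {1..n} \<Longrightarrow> norm (q i) = r"
    and m: "\<And>i. i \<in> {1..n} \<Longrightarrow> m i = \<mu>" and j: "j \<in> {1..n}" and "\<mu> \<noteq> 0"
  shows "lam * r\<^sup>2 = \<mu> / 2 * (\<Sum>i\<in>{1..n} - {j}. 1 / norm (q i - q j))"
proof -
  let ?S = "\<Sum>i\<in>{1..n} - {j}. 1 / norm (q i - q j)"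
  obtain g where g: "GDERIV (\<lambda>y. newton_potential n m (q(j := y))) (q j) :> g"
    "g + (lam * m j) *\<^sub>R q j = 0"
    using cc j unfolding central_configuration_def by blast
  have "((\<lambda>s. s *\<^sub>R q j) has_derivative (\<lambda>h. h *\<^sub>R q j)) (at 1)"
    by (auto intro!: derivative_eq_intros)
  moreover have "((\<lambda>y. newton_potential n m (q(j := y))) has_derivative (\<lambda>h. h \<bullet> g)) (at (1 *\<^sub>R q j))"
    using g(1) by (simp add: gderiv_def)
  ultimately have "((\<lambda>s. newton_potential n m (q(j := s *\<^sub>R q j))) has_derivative (\<lambda>h. (h *\<^sub>R q j) \<bullet> g)) (at 1)"
    by (rule has_derivative_compose)
  then have "((\<lambda>s. newton_potential n m (q(j := s *\<^sub>R q j))) has_real_derivative q j \<bullet> g) (at 1)"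
    by (simp add: has_field_derivative_def mult_commute_abs)
  moreover have "inj_on q {1..n}" using cc by (simp add: central_configuration_def)
  ultimately have "q j \<bullet> g = - (\<Sum>i\<in>{1..n} - {j}. m i * m j / (2 * norm (q i - q j)))"
    using newton_potential_radial_deriv[of q n r j m, OF _ norm j] DERIV_unique by blast
  also have "(\<Sum>i\<in>{1..n} - {j}. m i * m j / (2 * norm (q i - q j))) = \<mu>\<^sup>2 / 2 * ?S"
    unfolding sum_distrib_left by (rule sum.cong) (use m j in \<open>auto simp: power2_eq_square\<close>)
  finally have "q j \<bullet> g = - (\<mu>\<^sup>2 / 2 * ?S)" .
  moreover have "q j \<bullet> (g + (lam * m j) *\<^sub>R q j) = q j \<bullet> g + lam * \<mu> * r\<^sup>2"
    using norm[OF j] m[OF j] by (simp add: inner_add_right power2_norm_eq_inner[symmetric])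
  ultimately have "lam * \<mu> * r\<^sup>2 = \<mu>\<^sup>2 / 2 * ?S" using g(2) by simp
  then have "\<mu> * (lam * r\<^sup>2 - \<mu> / 2 * ?S) = 0"
    by (simp add: power2_eq_square algebra_simps)
  then show ?thesis using assms(5) by simp
qed

theorem corollary3:
  fixes n :: nat
    and m :: "nat \<Rightarrow> real"
    and q :: "nat \<Rightarrow> real ^ 3"
    and lam T :: real
    and x :: "nat \<Rightarrow> real \<Rightarrow> real ^ 3"
  assumes "n \<ge> 2"
    and "regular_polygon n q"
    and "\<forall>i \<in> {1..n}. m i = m 1"
    and "m 1 > 0"
    and "central_configuration n m q lam"
    and "\<forall>j \<in> {1..n}. \<forall>t. x j t = rigid_motion lam q j t"
    and "minimal_period (\<lambda>t. \<lambda>j \<in> {1..n}. x j t) T"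
  shows "(\<exists>z. synchronous_solution n m q T z) \<longleftrightarrow> 2 \<le> n \<and> n \<le> 472"
proof -
  obtain r j where r: "r > 0" and j: "j \<in> {1..n}" "q j $ 1 \<noteq> 0 \<or> q j $ 2 \<noteq> 0"
    and norm: "\<And>i. i \<in> {1..n} \<Longrightarrow> norm (q i) = r"
    and S: "(\<Sum>i\<in>{1..n} - {j}. 1 / norm (q i - q j)) = csc_sum n / (2 * r)"
    using regular_polygonE[OF assms(2,1)] by blast
  have m: "\<And>i. i \<in> {1..n} \<Longrightarrow> m i = m 1" using assms(3) by blast
  have "lam * r\<^sup>2 = m 1 / 2 * (csc_sum n / (2 * r))"
    unfolding S[symmetric] using assms(4)
    by (intro central_configuration_multiplier[OF assms(5) norm m j(1)]) auto
  then have lam: "lam = m 1 * csc_sum n / (4 * r ^ 3)"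
    using r by (simp add: field_simps eval_nat_numeral)
  then have lam_pos: "lam > 0" using assms(4) csc_sum_pos[OF assms(1)] r by simp
  have "(\<lambda>t. \<lambda>j \<in> {1..n}. x j t) = (\<lambda>t. \<lambda>j \<in> {1..n}. rigid_motion lam q j t)"
    using assms(6) by (auto simp: fun_eq_iff)
  then have T: "T = 2 * pi / sqrt lam"
    using assms(7) rigid_motion_minimal_period[OF lam_pos] j by metis
  interpret axis_motion "real n * m 1" r
    using assms(1,4) r by unfold_locales auto
  have acc: "(\<Sum>i = 1..n. m i * y / ((norm (q i))\<^sup>2 + y\<^sup>2) powr (3/2)) = acc y" for y
  proof -
    have "r\<^sup>2 + y\<^sup>2 > 0" using r by (simp add: add_pos_nonneg)
    then have "(r\<^sup>2 + y\<^sup>2) powr (3/2) = sqrt (r\<^sup>2 + y\<^sup>2) ^ 3"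
      by (simp add: powr_half_sqrt[symmetric] powr_powr flip: powr_numeral)
    moreover have "(\<Sum>i = 1..n. m i * y / ((norm (q i))\<^sup>2 + y\<^sup>2) powr (3/2))
      = (\<Sum>i = 1..n. m 1 * y / (r\<^sup>2 + y\<^sup>2) powr (3/2))"
      by (rule sum.cong[OF refl]) (metis norm m)
    ultimately show ?thesis unfolding acc_def by simp
  qed
  have "(\<exists>z. synchronous_solution n m q T z) \<longleftrightarrow> 2 * pi < freq * T"
    unfolding period_condition_iff[symmetric] synchronous_solution_def massless_particle_on_axis_def acc
    by blast
  also have "\<dots> \<longleftrightarrow> sqrt lam < freq"
  proof -
    have "freq * T = (2 * pi) * freq / sqrt lam" by (simp add: T)
    then show ?thesis using lam_pos by (simp add: pos_less_divide_eq)
  qed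
  also have "\<dots> \<longleftrightarrow> csc_sum n < 4 * real n"
  proof -
    define k where "k = m 1 / (4 * r ^ 3)"
    have k: "k > 0" using assms(4) r by (simp add: k_def)
    have "lam = k * csc_sum n" "real n * m 1 / r ^ 3 = k * (4 * real n)"
      by (simp_all add: lam k_def)
    then show ?thesis unfolding freq_def using k by simp
  qed
  also have "\<dots> \<longleftrightarrow> 2 \<le> n \<and> n \<le> 472"
    using csc_sum_less[of n] csc_sum_greater[of n] assms(1) by (cases "n \<le> 472") auto
  finally show ?thesis .
qed

end
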